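(* Let $\mathcal{A}$ be a well-behaved assemblage and let $m$ be the local complexity measure induced by $\mathcal{A}$. Then for any boolean function $f$ we have $m^{\lim}(f)=\hat{m}(f)$.
   Context: Boolean functions are maps $f:\{0,1\}^I\to\{0,1\}$ on a finite index set $I$; a weight function over $I$ is a map $I\to\mathbb{R}_{\ge 0}$, and $|w|=\sum_{i\in I}w(i)$. An assemblage $\mathcal{A}$ assigns to every boolean function $f$ on an index set $I$ and every $x\in\{0,1\}^I$ a compact (as a subset of $\mathbb{R}^I$) family $\mathcal{A}_x(f)$ of weight functions over $I$. The induced local measure is $m_x(f)=\min\{|w|: w\in\mathcal{A}_x(f)\}$; further $m_b(f)=\max\{m_x(f): f(x)=b\}$ for $b\in\{0,1\}$ and $m(f)=\max\{m_0(f),m_1(f)\}$. Compositions: if $f$ is on $I$ and $g$ on $J$, then $f\circ g$ is the function on $I\times J$ given by $(f\circ g)(z)=f\big((g(z_{i,\cdot}))_{i\in I}\big)$ where $z_{i,\cdot}\in\{0,1\}^J$ is the block of $z$ indexed by $\{i\}\times J$. Let $f^{(1)}=f$, $f^{(k)}=f\circ f^{(k-1)}$, and $m^{\lim}(f)=\liminf_{k\to\infty} m(f^{(k)})^{1/k}$. Well-behaved: Let $T$ be a finite rooted tree all of whose leaves are at the same depth, with leaf set $L(T)$ and, for an internal node $v$, children set $C(v)$. A $T$-ensemble of boolean functions is $(f_v)_{v \text{ internal}}$ with $f_v:\{0,1\}^{C(v)}\to\{0,1\}$; its composition $F$ is the function on $\{0,1\}^{L(T)}$ computed as a circuit: for input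 $\alpha$, set $b(\ell)=\alpha(\ell)$ for leaves and $b(v)=f_v(b_v)$ for internal $v$, where $b_v=(b(u))_{u\in C(v)}$; then $F(\alpha)=b(\text{root})$. A $T$-ensemble of weight functions $(w_v)$, $w_v:C(v)\to\mathbb{R}_{\ge0}$, composes to the weight function $w$ on $L(T)$ with $w(\ell)=\prod w_v(u)$ over the edges $(v,u)$ on the path from the root to $\ell$. Such an ensemble is compatible with $(f_v)$ and $\alpha$ if $w_v\in\mathcal{A}_{b_v}(f_v)$ for every internal $v$. The assemblage $\mathcal{A}$ is well-behaved if for every such $T$, every $T$-ensemble $(f_v)$ with composition $F$ and every input $\alpha$: (1) the composition of every weight-function ensemble compatible with $(f_v)$ and $\alpha$ belongs to $\mathcal{A}_\alpha(F)$; (2) for every $w\in\mathcal{A}_\alpha(F)$ there is a weight-function ensemble compatible with $(f_v)$ and $\alpha$ whose composition has total weight at most $|w|$. Characteristic value: an assignment selector for $f$ is a pair $\vec\alpha=(\alpha^0,\alpha^1)$ of assignments in $\{0,1\}^I$; it is $f$-compatible if $f(\alpha^0)=0$ and $f(\alpha^1)=1$. For a pair $\vec w=(w^0,w^1)$ of weight functions over $I$, the profile matrix $M_{\vec\alpha,\vec w}$ is the $2\times 2$ matrix with rows and columns indexed by $\{0,1\}$ whose $(s,t)$ entry is $\sum_{j:\alpha^s_j=t}w^s(j)$. For $f$-compatible $\vec\alpha$, $\hat m_{\vec\alpha}(f)$ is the minimum of $\rho(M_{\vec\alpha,\vec w})$ over all $\vec w$ with $w^0\in\mathcal{A}_{\alpha^0}(f)$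 and $w^1\in\mathcal{A}_{\alpha^1}(f)$, where $\rho$ denotes the spectral radius (largest absolute value of an eigenvalue); $\hat m(f)$ is the maximum of $\hat m_{\vec\alpha}(f)$ over all $f$-compatible $\vec\alpha$.
   Formalization: The boolean function f is assumed nonconstant, since for constant f there is no f-compatible selector and the maximum defining the characteristic value is over the empty set; the families of weight functions are taken nonempty so that the minima exist. *)

theory Defs
  imports
    "HOL-Analysis.Function_Topology"
    "HOL-Library.Extended_Real"
    "HOL-Library.Liminf_Limsup"
    "Jordan_Normal_Form.Spectral_Radius"
begin

text \<open>
  Bits are booleans. Functions on an index set (assignments, weight functions, boolean functions
  on the cube) are represented extensionally, i.e. with value \<^const>\<open>undefined\<close> outside
  their domain, so that equality of representatives is equality of functions.
\<close>

definition cube :: "'i set \<Rightarrow> ('i \<Rightarrow> bool) set" where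
  "cube I = I \<rightarrow>\<^sub>E UNIV"

record 'i bfun =
  index :: "'i set"
  eval :: "('i \<Rightarrow> bool) \<Rightarrow> bool"

definition is_bfun :: "'i bfun \<Rightarrow> bool" where
  "is_bfun f \<longleftrightarrow> finite (index f) \<and> eval f \<in> extensional (cube (index f))"

definition nonconstant :: "'i bfun \<Rightarrow> bool" where
  "nonconstant f \<longleftrightarrow>
     (\<exists>x \<in> cube (index f). \<exists>y \<in> cube (index f). eval f x \<noteq> eval f y)"

definition weights :: "'i set \<Rightarrow> ('i \<Rightarrow> real) set" where
  "weights I = I \<rightarrow>\<^sub>E {0..}"

definition total :: "'i set \<Rightarrow> ('i \<Rightarrow> real) \<Rightarrow> real" where
  "total I w = (\<Sum>i\<in>I. w i)"

type_synonym 'i family = "'i bfun \<Rightarrow> ('i \<Rightarrow> bool) \<Rightarrow> ('i \<Rightarrow> real) set"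

text \<open>
  Here \<^typ>\<open>'i\<close> is the universe from which index sets are drawn. The families are
  nonempty because the minimum of the total weight over each of them has to exist.
\<close>

definition assemblage :: "'i family \<Rightarrow> bool" where
  "assemblage A \<longleftrightarrow>
     (\<forall>f x. is_bfun f \<longrightarrow> x \<in> cube (index f) \<longrightarrow>
        A f x \<noteq> {} \<and> A f x \<subseteq> weights (index f) \<and>
        compactin (powertop_real (index f)) (A f x))"

text \<open>The infimum is a minimum: the total weight is continuous and \<open>A f x\<close> is compact.\<close>

definition local_measure :: "'i family \<Rightarrow> 'i bfun \<Rightarrow> ('i \<Rightarrow> bool) \<Rightarrow> real" where
  "local_measure A f x = Inf (total (index f) ` A f x)"

definition bit_measure :: "'i family \<Rightarrow> bool \<Rightarrow> 'i bfun \<Rightarrow> real" where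
  "bit_measure A b f = Max (local_measure A f ` {x \<in> cube (index f). eval f x = b})"

definition measure_of_family :: "'i family \<Rightarrow> 'i bfun \<Rightarrow> real" where
  "measure_of_family A f = max (bit_measure A False f) (bit_measure A True f)"


text \<open>
  A universe of indices closed under pairing, so that \<open>I \<times> J\<close> is again a set of indices
  of the same type.
\<close>

datatype 'a label = Atom 'a | Pr "'a label" "'a label"

definition label_times :: "'a label set \<Rightarrow> 'a label set \<Rightarrow> 'a label set" where
  "label_times I J = {Pr i j | i j. i \<in> I \<and> j \<in> J}"

definition bfun_comp :: "'a label bfun \<Rightarrow> 'a label bfun \<Rightarrow> 'a label bfun" where
  "bfun_comp f g =
     \<lparr> index = label_times (index f) (index g),
       eval = (\<lambda>z \<in> cube (label_times (index f) (index g)).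
                 eval f (\<lambda>i \<in> index f. eval g (\<lambda>j \<in> index g. z (Pr i j)))) \<rparr>"

text \<open>The power is meant for exponents \<open>k \<ge> 1\<close>; the value at \<open>0\<close> is a dummy.\<close>

fun bfun_pow :: "'a label bfun \<Rightarrow> nat \<Rightarrow> 'a label bfun" where
  "bfun_pow f 0 = f"
| "bfun_pow f (Suc 0) = f"
| "bfun_pow f (Suc (Suc k)) = bfun_comp f (bfun_pow f (Suc k))"

definition measure_lim :: "'a label family \<Rightarrow> 'a label bfun \<Rightarrow> ereal" where
  "measure_lim A f = liminf (\<lambda>k. ereal (root k (measure_of_family A (bfun_pow f k))))"


text \<open>Edges point from parent to child.\<close>

record 'i rtree =
  nodes :: "'i set"
  top_node :: 'i
  edges :: "('i \<times> 'i) set"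

definition rooted_tree :: "'i rtree \<Rightarrow> bool" where
  "rooted_tree T \<longleftrightarrow>
     finite (nodes T) \<and> top_node T \<in> nodes T \<and> edges T \<subseteq> nodes T \<times> nodes T \<and>
     (\<forall>v. (v, top_node T) \<notin> edges T) \<and>
     (\<forall>u \<in> nodes T - {top_node T}. \<exists>!v. (v, u) \<in> edges T) \<and>
     (\<forall>u \<in> nodes T. (top_node T, u) \<in> (edges T)\<^sup>*)"

definition children :: "'i rtree \<Rightarrow> 'i \<Rightarrow> 'i set" where
  "children T v = {u. (v, u) \<in> edges T}"

definition leaves :: "'i rtree \<Rightarrow> 'i set" where
  "leaves T = {v \<in> nodes T. children T v = {}}"

definition internal :: "'i rtree \<Rightarrow> 'i set" where
  "internal T = nodes T - leaves T"

definition equal_depth :: "'i rtree \<Rightarrow> bool" where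
  "equal_depth T \<longleftrightarrow> (\<exists>d. \<forall>l \<in> leaves T. (top_node T, l) \<in> edges T ^^ d)"

definition bfun_ensemble :: "'i rtree \<Rightarrow> ('i \<Rightarrow> 'i bfun) \<Rightarrow> bool" where
  "bfun_ensemble T fs \<longleftrightarrow>
     (\<forall>v \<in> internal T. is_bfun (fs v) \<and> index (fs v) = children T v)"

definition is_node_values ::
    "'i rtree \<Rightarrow> ('i \<Rightarrow> 'i bfun) \<Rightarrow> ('i \<Rightarrow> bool) \<Rightarrow> ('i \<Rightarrow> bool) \<Rightarrow> bool" where
  "is_node_values T fs \<alpha> b \<longleftrightarrow>
     b \<in> extensional (nodes T) \<and>
     (\<forall>l \<in> leaves T. b l = \<alpha> l) \<and>
     (\<forall>v \<in> internal T. b v = eval (fs v) (restrict b (children T v)))"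

definition node_values :: "'i rtree \<Rightarrow> ('i \<Rightarrow> 'i bfun) \<Rightarrow> ('i \<Rightarrow> bool) \<Rightarrow> 'i \<Rightarrow> bool" where
  "node_values T fs \<alpha> = (THE b. is_node_values T fs \<alpha> b)"

definition tree_bfun :: "'i rtree \<Rightarrow> ('i \<Rightarrow> 'i bfun) \<Rightarrow> 'i bfun" where
  "tree_bfun T fs =
     \<lparr> index = leaves T,
       eval = (\<lambda>\<alpha> \<in> cube (leaves T). node_values T fs \<alpha> (top_node T)) \<rparr>"

text \<open>In a rooted tree these are exactly the edges of the path from the root to \<open>l\<close>.\<close>

definition path_edges :: "'i rtree \<Rightarrow> 'i \<Rightarrow> ('i \<times> 'i) set" where
  "path_edges T l = {(v, u) \<in> edges T. (u, l) \<in> (edges T)\<^sup>*}"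

definition tree_weight :: "'i rtree \<Rightarrow> ('i \<Rightarrow> 'i \<Rightarrow> real) \<Rightarrow> 'i \<Rightarrow> real" where
  "tree_weight T ws = (\<lambda>l \<in> leaves T. \<Prod>(v, u) \<in> path_edges T l. ws v u)"

definition compatible_weights ::
    "'i family \<Rightarrow> 'i rtree \<Rightarrow> ('i \<Rightarrow> 'i bfun) \<Rightarrow> ('i \<Rightarrow> bool) \<Rightarrow> ('i \<Rightarrow> 'i \<Rightarrow> real) \<Rightarrow> bool" where
  "compatible_weights A T fs \<alpha> ws \<longleftrightarrow>
     (\<forall>v \<in> internal T. ws v \<in> weights (children T v) \<and>
        ws v \<in> A (fs v) (restrict (node_values T fs \<alpha>) (children T v)))"

definition well_behaved :: "'i family \<Rightarrow> bool" where
  "well_behaved A \<longleftrightarrow>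
     (\<forall>T fs \<alpha>. rooted_tree T \<longrightarrow> equal_depth T \<longrightarrow> bfun_ensemble T fs \<longrightarrow> \<alpha> \<in> cube (leaves T) \<longrightarrow>
        (\<forall>ws. compatible_weights A T fs \<alpha> ws \<longrightarrow> tree_weight T ws \<in> A (tree_bfun T fs) \<alpha>) \<and>
        (\<forall>w \<in> A (tree_bfun T fs) \<alpha>. \<exists>ws. compatible_weights A T fs \<alpha> ws \<and>
            total (leaves T) (tree_weight T ws) \<le> total (leaves T) w))"


text \<open>
  Pairs indexed by bits are functions on \<^typ>\<open>bool\<close>. Rows and columns of the profile matrix
  are numbered 0 and 1, with number \<open>s\<close> standing for the bit \<open>s = 1\<close>.
\<close>

definition compatible_selector :: "'i bfun \<Rightarrow> (bool \<Rightarrow> 'i \<Rightarrow> bool) \<Rightarrow> bool" where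
  "compatible_selector f \<alpha> \<longleftrightarrow> (\<forall>b. \<alpha> b \<in> cube (index f) \<and> eval f (\<alpha> b) = b)"

definition profile_matrix ::
    "'i set \<Rightarrow> (bool \<Rightarrow> 'i \<Rightarrow> bool) \<Rightarrow> (bool \<Rightarrow> 'i \<Rightarrow> real) \<Rightarrow> complex mat" where
  "profile_matrix I \<alpha> w =
     mat 2 2 (\<lambda>(s, t). complex_of_real (\<Sum>j \<in> {j \<in> I. \<alpha> (s = 1) j = (t = 1)}. w (s = 1) j))"

text \<open>
  Again the infimum is a minimum, since the spectral radius is continuous and both families are
  compact.
\<close>

definition selector_value :: "'i family \<Rightarrow> 'i bfun \<Rightarrow> (bool \<Rightarrow> 'i \<Rightarrow> bool) \<Rightarrow> real" where
  "selector_value A f \<alpha> =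
     Inf {spectral_radius (profile_matrix (index f) \<alpha> w) | w. \<forall>b. w b \<in> A f (\<alpha> b)}"

definition characteristic_value :: "'i family \<Rightarrow> 'i bfun \<Rightarrow> real" where
  "characteristic_value A f = Max (selector_value A f ` {\<alpha>. compatible_selector f \<alpha>})"


lemma rooted_tree_acyclic:
  assumes "rooted_tree T"
  shows "acyclic (edges T)"
proof -
  have sub: "edges T \<subseteq> nodes T \<times> nodes T" and top: "\<And>v. (v, top_node T) \<notin> edges T"
    and reach: "\<And>u. u \<in> nodes T \<Longrightarrow> (top_node T, u) \<in> (edges T)\<^sup>*"
    and uniq: "\<And>u v v'. (v, u) \<in> edges T \<Longrightarrow> (v', u) \<in> edges T \<Longrightarrow> v = v'"
    using assms unfolding rooted_tree_def by (auto, metis DiffI SigmaD2 singletonD subsetD)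
  have no: "(x, x) \<notin> (edges T)\<^sup>+" if "(top_node T, x) \<in> (edges T)\<^sup>*" for x
    using that
  proof (induction rule: rtrancl_induct)
    case base
    then show ?case using top by (meson tranclE)
  next
    case (step y z)
    show ?case
    proof
      assume "(z, z) \<in> (edges T)\<^sup>+"
      then obtain p where "(z, p) \<in> (edges T)\<^sup>*" "(p, z) \<in> edges T" by (meson tranclD2)
      then have "(z, y) \<in> (edges T)\<^sup>*" using uniq step(2) by blast
      then have "(y, y) \<in> (edges T)\<^sup>+" using step(2) by (meson rtrancl_into_trancl2)
      then show False using step by blast
    qed
  qed
  show ?thesis
  proof (rule acyclicI, intro allI notI)
    fix x assume x: "(x, x) \<in> (edges T)\<^sup>+"
    then have "x \<in> nodes T" using sub by (meson SigmaD1 subsetD tranclD)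
    then show False using x no reach by blast
  qed
qed

lemma ex1_node_values:
  assumes T: "rooted_tree T"
  shows "\<exists>!b. is_node_values T fs \<alpha> b"
proof -
  have sub: "edges T \<subseteq> nodes T \<times> nodes T" and fin: "finite (edges T)"
    using T unfolding rooted_tree_def by (auto intro: finite_subset)
  have wf: "wf ((edges T)\<inverse>)"
    using finite_acyclic_wf_converse[OF fin rooted_tree_acyclic[OF T]] .
  define H where "H = (\<lambda>b v. if v \<notin> nodes T then undefined else if v \<in> leaves T then \<alpha> v
     else eval (fs v) (restrict b (children T v)))"
  define b where "b = wfrec ((edges T)\<inverse>) H"
  have cut: "restrict (cut b ((edges T)\<inverse>) v) (children T v) = restrict b (children T v)" for v
    by (auto simp: restrict_def cut_def children_def)
  have b: "b v = H b v" for v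
    using def_wfrec[OF eq_reflection[OF b_def] wf, of v] by (simp add: H_def cut)
  have "is_node_values T fs \<alpha> b"
    unfolding is_node_values_def
    by (auto simp: extensional_def internal_def leaves_def b[unfolded H_def])
  moreover have "c = b" if c: "is_node_values T fs \<alpha> c" for c
  proof
    fix v
    show "c v = b v"
      using wf
    proof (induction v rule: wf_induct_rule)
      case (less v)
      then have "restrict c (children T v) = restrict b (children T v)"
        by (auto simp: restrict_def children_def)
      then show ?case
        using c unfolding is_node_values_def b[of v] H_def
        by (auto simp: extensional_def internal_def)
    qed
  qed
  ultimately show ?thesis by blast
qed

end

theory Submission
  imports Defs "HOL-Analysis.Elementary_Metric_Spaces"
begin

text \<open>
  Applied to trees of depth two, well-behavedness says that
  \<open>m\<^sub>z(f \<circ> g) = min\<^sub>w \<Sum>\<^sub>i w(i) m\<^bsub>z(i)\<^esub>(g)\<close>, where \<open>z(i)\<close> are the blocks of \<open>z\<close> and \<open>w\<close> ranges over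
  \<open>A\<^sub>x(f)\<close> for the vector \<open>x\<close> of values of \<open>g\<close> on these blocks. Hence the pair \<open>(m\<^sub>0, m\<^sub>1)\<close> of the
  \<open>k\<close>-th iterate is \<open>\<Psi>\<^sup>k(1, 1)\<close> for the monotone homogeneous map
  \<open>\<Psi>\<^sub>b(v) = max\<^bsub>f(x) = b\<^esub> min\<^sub>w \<Sum>\<^sub>i w(i) v\<^bsub>x(i)\<^esub>\<close>, and its growth rate is squeezed between sub- and
  superinvariant vectors. If \<open>\<kappa>\<close> exceeds the characteristic value, every selector has a profile
  matrix \<open>M\<close> and some \<open>v = (1, t)\<close>, \<open>t > 0\<close>, with \<open>M v \<le> \<kappa> v\<close>. The condition of row 0 is preserved
  when \<open>t\<close> decreases and that of row 1 when \<open>t\<close> increases, so a minimax choice of \<open>t\<close> serves all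
  selectors at once. If \<open>\<kappa>\<close> is below the value of a selector, a connectedness argument on a segment
  gives a nonzero \<open>v \<ge> 0\<close> with \<open>\<kappa> v \<le> \<Psi>(v)\<close>.

  An assemblage is not assumed to be invariant under renaming of indices. This is derived for
  minimal weighted costs, by composing with identity functions.
\<close>


section \<open>Minimal weighted costs\<close>

definition min_cost :: "'i family \<Rightarrow> 'i bfun \<Rightarrow> ('i \<Rightarrow> bool) \<Rightarrow> ('i \<Rightarrow> real) \<Rightarrow> real" where
  "min_cost A f x c = Inf ((\<lambda>w. \<Sum>i\<in>index f. w i * c i) ` A f x)"

lemma local_measure_eq_min_cost: "local_measure A f x = min_cost A f x (\<lambda>_. 1)"
  by (simp add: local_measure_def min_cost_def total_def [abs_def])

lemma min_cost_cong:
  assumes "\<And>i. i \<in> index f \<Longrightarrow> c i = d i"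
  shows "min_cost A f x c = min_cost A f x d"
  unfolding min_cost_def using assms by simp

lemma restrict_in_cube [simp]: "restrict x I \<in> cube I"
  by (simp add: cube_def)

lemma restrict_cube [simp]: "x \<in> cube I \<Longrightarrow> restrict x I = x"
  by (simp add: cube_def)

lemma finite_cube: "finite I \<Longrightarrow> finite (cube I)"
  by (simp add: cube_def finite_PiE)

lemma is_bfun_finite: "is_bfun f \<Longrightarrow> finite (index f)"
  by (simp add: is_bfun_def)

locale compact_assemblage =
  fixes A :: "'i family"
  assumes assemblage: "assemblage A"
begin

context
  fixes f :: "'i bfun" and x :: "'i \<Rightarrow> bool"
  assumes f: "is_bfun f" and x: "x \<in> cube (index f)"
begin

lemma family_nonempty: "A f x \<noteq> {}"
  and family_weights: "w \<in> A f x \<Longrightarrow> w \<in> weights (index f)"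
  and family_compact: "compactin (powertop_real (index f)) (A f x)"
  using assemblage f x unfolding assemblage_def by blast+

lemma family_nonneg: "w \<in> A f x \<Longrightarrow> i \<in> index f \<Longrightarrow> 0 \<le> w i"
  using family_weights by (fastforce simp: weights_def)

lemma compact_costs: "compact ((\<lambda>w. \<Sum>i\<in>index f. w i * c i) ` A f x)"
proof -
  have "continuous_map (powertop_real (index f)) euclideanreal (\<lambda>w. \<Sum>i\<in>index f. w i * c i)"
    using is_bfun_finite[OF f]
    by (intro continuous_map_sum continuous_map_real_mult continuous_map_product_projection) auto
  then show ?thesis
    using image_compactin[OF family_compact] by fastforce
qed

lemma min_cost_attained:
  obtains w where "w \<in> A f x" "min_cost A f x c = (\<Sum>i\<in>index f. w i * c i)"
proof -
  have "min_cost A f x c \<in> (\<lambda>w. \<Sum>i\<in>index f. w i * c i) ` A f x"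
    unfolding min_cost_def using compact_costs family_nonempty
    by (intro closed_contains_Inf compact_imp_closed bounded_imp_bdd_below compact_imp_bounded) auto
  then show thesis using that by blast
qed

lemma min_cost_le:
  assumes "w \<in> A f x"
  shows "min_cost A f x c \<le> (\<Sum>i\<in>index f. w i * c i)"
  unfolding min_cost_def using assms compact_costs
  by (intro cInf_lower imageI bounded_imp_bdd_below compact_imp_bounded)

lemma le_min_cost_iff: "K \<le> min_cost A f x c \<longleftrightarrow> (\<forall>w\<in>A f x. K \<le> (\<Sum>i\<in>index f. w i * c i))"
  using min_cost_le min_cost_attained by (metis order_trans)

lemma min_cost_nonneg:
  assumes "\<And>i. i \<in> index f \<Longrightarrow> 0 \<le> c i"
  shows "0 \<le> min_cost A f x c"
  unfolding le_min_cost_iff using assms family_nonneg by (auto intro!: sum_nonneg)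

lemma min_cost_mono:
  assumes "\<And>i. i \<in> index f \<Longrightarrow> c i \<le> d i"
  shows "min_cost A f x c \<le> min_cost A f x d"
  unfolding le_min_cost_iff
proof
  fix w assume w: "w \<in> A f x"
  then have "(\<Sum>i\<in>index f. w i * c i) \<le> (\<Sum>i\<in>index f. w i * d i)"
    using assms family_nonneg by (intro sum_mono mult_left_mono) auto
  then show "min_cost A f x c \<le> (\<Sum>i\<in>index f. w i * d i)"
    using min_cost_le[OF w] by (rule order_trans[rotated])
qed

lemma min_cost_mult_left:
  assumes "0 \<le> k"
  shows "min_cost A f x (\<lambda>i. k * c i) = k * min_cost A f x c"
proof -
  have scaled: "(\<Sum>i\<in>index f. w i * (k * c i)) = k * (\<Sum>i\<in>index f. w i * c i)" for w
    by (simp add: sum_distrib_left mult_ac)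
  show ?thesis
  proof (rule antisym)
    obtain w where "w \<in> A f x" "min_cost A f x c = (\<Sum>i\<in>index f. w i * c i)"
      by (rule min_cost_attained)
    then show "min_cost A f x (\<lambda>i. k * c i) \<le> k * min_cost A f x c"
      using min_cost_le scaled by metis
    show "k * min_cost A f x c \<le> min_cost A f x (\<lambda>i. k * c i)"
      unfolding le_min_cost_iff scaled using min_cost_le assms by (blast intro: mult_left_mono)
  qed
qed

end

end


section \<open>Trees of depth two\<close>

locale two_level_tree =
  fixes r :: 'i and C :: "'i set" and J :: "'i \<Rightarrow> 'i set"
  assumes finite_middle: "finite C" and finite_block: "k \<in> C \<Longrightarrow> finite (J k)"
    and middle_nonempty: "C \<noteq> {}" and block_nonempty: "k \<in> C \<Longrightarrow> J k \<noteq> {}"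
    and disjoint_blocks: "disjoint_family_on J C"
    and block_Int_middle: "k \<in> C \<Longrightarrow> J k \<inter> C = {}"
    and root_notin: "r \<notin> C \<union> (\<Union>k\<in>C. J k)"
begin

definition tree :: "'i rtree" where
  "tree = \<lparr> nodes = insert r (C \<union> (\<Union>k\<in>C. J k)), top_node = r,
     edges = {r} \<times> C \<union> (SIGMA k:C. J k) \<rparr>"

lemma top_node_tree [simp]: "top_node tree = r"
  by (simp add: tree_def)

lemma nodes_tree: "nodes tree = insert r (C \<union> (\<Union>k\<in>C. J k))"
  by (simp add: tree_def)

lemma edges_tree_iff: "(v, u) \<in> edges tree \<longleftrightarrow> v = r \<and> u \<in> C \<or> v \<in> C \<and> u \<in> J v"
  by (auto simp: tree_def)

lemma middle_notin_block: "k \<in> C \<Longrightarrow> l \<in> C \<Longrightarrow> l \<notin> J k"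
  using block_Int_middle by blast

lemma block_unique: "k \<in> C \<Longrightarrow> l \<in> C \<Longrightarrow> j \<in> J k \<Longrightarrow> j \<in> J l \<Longrightarrow> k = l"
  using disjoint_blocks by (auto simp: disjoint_family_on_def)

lemma children_root [simp]: "children tree r = C"
  using root_notin by (auto simp: children_def edges_tree_iff)

lemma children_middle [simp]: "k \<in> C \<Longrightarrow> children tree k = J k"
  using root_notin by (auto simp: children_def edges_tree_iff)

lemma children_block [simp]: "k \<in> C \<Longrightarrow> j \<in> J k \<Longrightarrow> children tree j = {}"
  using root_notin middle_notin_block by (auto simp: children_def edges_tree_iff)

lemma leaves_tree: "leaves tree = (\<Union>k\<in>C. J k)"
  using middle_nonempty block_nonempty by (auto simp: leaves_def nodes_tree)

lemma internal_tree: "internal tree = insert r C"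
  unfolding internal_def leaves_tree using root_notin middle_notin_block by (auto simp: tree_def)

lemma leaf_depth: "l \<in> leaves tree \<Longrightarrow> (r, l) \<in> edges tree ^^ 2"
  by (auto simp: leaves_tree edges_tree_iff numeral_2_eq_2)

lemma equal_depth_tree: "equal_depth tree"
  unfolding equal_depth_def using leaf_depth by auto

lemma parent_middle: "k \<in> C \<Longrightarrow> (v, k) \<in> edges tree \<longleftrightarrow> v = r"
  using middle_notin_block by (auto simp: edges_tree_iff)

lemma parent_block: "k \<in> C \<Longrightarrow> j \<in> J k \<Longrightarrow> (v, j) \<in> edges tree \<longleftrightarrow> v = k"
  using middle_notin_block block_unique by (auto simp: edges_tree_iff)

lemma no_parent_root: "(v, r) \<notin> edges tree"
  using root_notin by (auto simp: edges_tree_iff)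

lemma rooted_tree_tree: "rooted_tree tree"
  unfolding rooted_tree_def
proof (intro conjI ballI allI)
  show "finite (nodes tree)" "top_node tree \<in> nodes tree" "edges tree \<subseteq> nodes tree \<times> nodes tree"
    using finite_middle finite_block by (auto simp: tree_def)
  show "(v, top_node tree) \<notin> edges tree" for v
    by (simp add: no_parent_root)
next
  fix u assume "u \<in> nodes tree - {top_node tree}"
  then consider "u \<in> C" | k where "k \<in> C" "u \<in> J k"
    by (auto simp: tree_def)
  then show "\<exists>!v. (v, u) \<in> edges tree"
    by cases (simp_all add: parent_middle parent_block)
next
  fix u assume "u \<in> nodes tree"
  then consider (root) "u = r" | (middle) "u \<in> C" | (leaf) "u \<in> leaves tree"
    unfolding leaves_tree by (auto simp: tree_def)
  then show "(top_node tree, u) \<in> (edges tree)\<^sup>*"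
  proof cases
    case middle
    then show ?thesis by (auto simp: edges_tree_iff)
  next
    case leaf
    then show ?thesis using leaf_depth relpow_imp_rtrancl by fastforce
  qed simp
qed

lemma path_edges_tree:
  assumes k: "k \<in> C" and j: "j \<in> J k"
  shows "path_edges tree j = {(r, k), (k, j)}"
proof -
  have ancestors: "(u, j) \<in> (edges tree)\<^sup>* \<longleftrightarrow> u \<in> {r, k, j}" for u
  proof
    assume "(u, j) \<in> (edges tree)\<^sup>*"
    then show "u \<in> {r, k, j}"
      by (induction rule: converse_rtrancl_induct)
        (use k j in \<open>auto simp: parent_middle parent_block no_parent_root\<close>)
  next
    have "(r, k) \<in> edges tree" "(k, j) \<in> edges tree"
      using k j by (auto simp: edges_tree_iff)
    then show "u \<in> {r, k, j} \<Longrightarrow> (u, j) \<in> (edges tree)\<^sup>*"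
      by (auto intro: converse_rtrancl_into_rtrancl)
  qed
  then show ?thesis
    unfolding path_edges_def
    using k j by (auto simp: parent_middle parent_block no_parent_root)
qed

lemma tree_weight_tree:
  assumes "k \<in> C" "j \<in> J k"
  shows "tree_weight tree ws j = ws r k * ws k j"
proof -
  have "(r, k) \<noteq> (k, j)"
    using assms root_notin by auto
  with assms show ?thesis
    by (auto simp: tree_weight_def leaves_tree path_edges_tree)
qed

lemma sum_tree_weight:
  "(\<Sum>l\<in>leaves tree. tree_weight tree ws l * c l) = (\<Sum>k\<in>C. ws r k * (\<Sum>j\<in>J k. ws k j * c j))"
proof -
  have "(\<Sum>l\<in>leaves tree. tree_weight tree ws l * c l)
      = (\<Sum>k\<in>C. \<Sum>j\<in>J k. tree_weight tree ws j * c j)"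
    unfolding leaves_tree using finite_middle finite_block block_unique
    by (intro sum.UNION_disjoint) auto
  then show ?thesis
    by (simp add: tree_weight_tree sum_distrib_left mult.assoc)
qed

end

definition inner_values :: "'i bfun \<Rightarrow> ('i \<Rightarrow> 'j bfun) \<Rightarrow> ('j \<Rightarrow> bool) \<Rightarrow> 'i \<Rightarrow> bool" where
  "inner_values h g z = (\<lambda>k \<in> index h. eval (g k) (restrict z (index (g k))))"

definition graft :: "'i bfun \<Rightarrow> ('i \<Rightarrow> 'j bfun) \<Rightarrow> 'j bfun" where
  "graft h g =
     \<lparr> index = (\<Union>k\<in>index h. index (g k)),
       eval = (\<lambda>z \<in> cube (\<Union>k\<in>index h. index (g k)). eval h (inner_values h g z)) \<rparr>"

lemma index_graft: "index (graft h g) = (\<Union>k\<in>index h. index (g k))"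
  by (simp add: graft_def)

lemma inner_values_in_cube [simp]: "inner_values h g z \<in> cube (index h)"
  by (simp add: inner_values_def)

locale two_level_ensemble =
  two_level_tree r "index h" "\<lambda>k. index (g k)"
  for r :: 'i and h :: "'i bfun" and g :: "'i \<Rightarrow> 'i bfun" +
  assumes is_bfun_outer: "is_bfun h" and is_bfun_inner: "k \<in> index h \<Longrightarrow> is_bfun (g k)"
begin

lemma bfun_ensemble_tree: "bfun_ensemble tree (g(r := h))"
  using root_notin is_bfun_outer is_bfun_inner by (auto simp: bfun_ensemble_def internal_tree)

lemma is_node_values_tree:
  "is_node_values tree (g(r := h)) z (node_values tree (g(r := h)) z)"
  unfolding node_values_def by (rule theI'[OF ex1_node_values[OF rooted_tree_tree]])

lemma node_values_block:
  assumes "k \<in> index h"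
  shows "restrict (node_values tree (g(r := h)) z) (index (g k)) = restrict z (index (g k))"
  using is_node_values_tree assms
  by (intro restrict_ext) (auto simp: is_node_values_def leaves_tree)

lemma node_values_middle:
  "restrict (node_values tree (g(r := h)) z) (index h) = inner_values h g z"
  unfolding inner_values_def
proof (rule restrict_ext)
  fix k assume k: "k \<in> index h"
  have "node_values tree (g(r := h)) z k
      = eval (g k) (restrict (node_values tree (g(r := h)) z) (index (g k)))"
    using is_node_values_tree[of z] k root_notin
    by (auto simp: is_node_values_def internal_tree)
  then show "node_values tree (g(r := h)) z k = eval (g k) (restrict z (index (g k)))"
    by (simp add: node_values_block[OF k])
qed

lemma node_values_root: "node_values tree (g(r := h)) z r = eval h (inner_values h g z)"
  using is_node_values_tree[of z] node_values_middle[of z]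
  by (auto simp: is_node_values_def internal_tree)

lemma tree_bfun_tree: "tree_bfun tree (g(r := h)) = graft h g"
  by (simp add: tree_bfun_def graft_def leaves_tree node_values_root)

lemma compatible_weights_iff:
  assumes "assemblage A"
  shows "compatible_weights A tree (g(r := h)) z ws \<longleftrightarrow>
    ws r \<in> A h (inner_values h g z) \<and>
    (\<forall>k\<in>index h. ws k \<in> A (g k) (restrict z (index (g k))))"
proof -
  interpret compact_assemblage A
    using assms by unfold_locales
  show ?thesis
    unfolding compatible_weights_def internal_tree
    using root_notin family_weights[OF is_bfun_outer inner_values_in_cube]
      family_weights[OF is_bfun_inner restrict_in_cube]
    by (auto simp: node_values_middle node_values_block)
qed

context
  fixes A :: "'i family" and z :: "'i \<Rightarrow> bool"
  assumes well_behaved: "well_behaved A" and z: "z \<in> cube (index (graft h g))"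
begin

lemma tree_weight_in_family:
  "compatible_weights A tree (g(r := h)) z ws \<Longrightarrow> tree_weight tree ws \<in> A (graft h g) z"
  and ex_compatible_weights:
  "W \<in> A (graft h g) z \<Longrightarrow> \<exists>ws. compatible_weights A tree (g(r := h)) z ws \<and>
     total (leaves tree) (tree_weight tree ws) \<le> total (leaves tree) W"
proof -
  have "z \<in> cube (leaves tree)"
    using z by (simp add: index_graft leaves_tree)
  from well_behaved[unfolded well_behaved_def, rule_format,
      OF rooted_tree_tree equal_depth_tree bfun_ensemble_tree this]
  show "compatible_weights A tree (g(r := h)) z ws \<Longrightarrow> tree_weight tree ws \<in> A (graft h g) z"
    and "W \<in> A (graft h g) z \<Longrightarrow> \<exists>ws. compatible_weights A tree (g(r := h)) z ws \<and>
      total (leaves tree) (tree_weight tree ws) \<le> total (leaves tree) W"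
    by (simp_all add: tree_bfun_tree)
qed

end

end

definition graftable :: "'i bfun \<Rightarrow> ('i \<Rightarrow> 'i bfun) \<Rightarrow> bool" where
  "graftable h g \<longleftrightarrow>
     is_bfun h \<and> index h \<noteq> {} \<and> disjoint_family_on (\<lambda>k. index (g k)) (index h) \<and>
     (\<forall>k\<in>index h. is_bfun (g k) \<and> index (g k) \<noteq> {} \<and> index (g k) \<inter> index h = {})"

lemma graftable_two_level_ensemble:
  fixes h :: "'i bfun"
  assumes "graftable h g" and "infinite (UNIV :: 'i set)"
  obtains r where "two_level_ensemble r h g"
proof -
  have "finite (index h \<union> (\<Union>k\<in>index h. index (g k)))"
    using assms(1) by (auto simp: graftable_def is_bfun_def)
  then obtain r where "r \<notin> index h \<union> (\<Union>k\<in>index h. index (g k))"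
    using assms(2) ex_new_if_finite by blast
  then have "two_level_ensemble r h g"
    using assms(1) by unfold_locales (auto simp: graftable_def is_bfun_def)
  then show thesis by (rule that)
qed

lemma is_bfun_graft:
  assumes "graftable h g"
  shows "is_bfun (graft h g)"
  using assms by (auto simp: graftable_def graft_def is_bfun_def)

locale well_behaved_assemblage = compact_assemblage A for A :: "'i family" +
  assumes well_behaved: "well_behaved A" and infinite_labels: "infinite (UNIV :: 'i set)"
begin

lemma min_cost_graft_le:
  assumes graftable: "graftable h g" and z: "z \<in> cube (index (graft h g))"
  shows "min_cost A (graft h g) z c \<le>
    min_cost A h (inner_values h g z) (\<lambda>k. min_cost A (g k) (restrict z (index (g k))) c)"
    (is "_ \<le> min_cost A h ?b ?m")
proof -
  obtain r where "two_level_ensemble r h g"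
    using graftable_two_level_ensemble[OF graftable infinite_labels] .
  then interpret two_level_ensemble r h g .
  obtain w where w: "w \<in> A h ?b" "min_cost A h ?b ?m = (\<Sum>k\<in>index h. w k * ?m k)"
    using min_cost_attained[OF is_bfun_outer inner_values_in_cube] .
  have "\<exists>v. v \<in> A (g k) (restrict z (index (g k))) \<and> ?m k = (\<Sum>j\<in>index (g k). v j * c j)"
    if "k \<in> index h" for k
    using min_cost_attained[OF is_bfun_inner[OF that] restrict_in_cube] by metis
  then obtain u where u: "k \<in> index h \<Longrightarrow> u k \<in> A (g k) (restrict z (index (g k)))"
    "k \<in> index h \<Longrightarrow> ?m k = (\<Sum>j\<in>index (g k). u k j * c j)" for k
    by metis
  have "compatible_weights A tree (g(r := h)) z (u(r := w))"
    unfolding compatible_weights_iff[OF assemblage] using w(1) u(1) root_notin by auto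
  then have "tree_weight tree (u(r := w)) \<in> A (graft h g) z"
    by (rule tree_weight_in_family[OF well_behaved z])
  then have "min_cost A (graft h g) z c \<le> (\<Sum>l\<in>leaves tree. tree_weight tree (u(r := w)) l * c l)"
    using min_cost_le[OF is_bfun_graft[OF graftable] z] by (simp add: index_graft leaves_tree)
  also have "\<dots> = min_cost A h ?b ?m"
    unfolding sum_tree_weight w(2) using root_notin by (auto simp: u(2) intro!: sum.cong)
  finally show ?thesis .
qed

lemma local_measure_graft:
  assumes graftable: "graftable h g" and z: "z \<in> cube (index (graft h g))"
  shows "local_measure A (graft h g) z =
    min_cost A h (inner_values h g z) (\<lambda>k. local_measure A (g k) (restrict z (index (g k))))"
proof (rule antisym)
  show "local_measure A (graft h g) z \<le>
      min_cost A h (inner_values h g z) (\<lambda>k. local_measure A (g k) (restrict z (index (g k))))"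
    unfolding local_measure_eq_min_cost by (rule min_cost_graft_le[OF graftable z])
next
  obtain r where "two_level_ensemble r h g"
    using graftable_two_level_ensemble[OF graftable infinite_labels] .
  then interpret two_level_ensemble r h g .
  obtain W where W: "W \<in> A (graft h g) z"
    "local_measure A (graft h g) z = total (leaves tree) W"
    using min_cost_attained[OF is_bfun_graft[OF graftable] z, of "\<lambda>_. 1"]
    by (auto simp: local_measure_eq_min_cost total_def index_graft leaves_tree)
  obtain ws where "compatible_weights A tree (g(r := h)) z ws"
    and total_le: "total (leaves tree) (tree_weight tree ws) \<le> total (leaves tree) W"
    using ex_compatible_weights[OF well_behaved z W(1)] by blast
  then have w: "ws r \<in> A h (inner_values h g z)"
    and u: "k \<in> index h \<Longrightarrow> ws k \<in> A (g k) (restrict z (index (g k)))" for k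
    by (auto simp: compatible_weights_iff[OF assemblage])
  have "min_cost A h (inner_values h g z) (\<lambda>k. local_measure A (g k) (restrict z (index (g k))))
      \<le> (\<Sum>k\<in>index h. ws r k * local_measure A (g k) (restrict z (index (g k))))"
    by (rule min_cost_le[OF is_bfun_outer inner_values_in_cube w])
  also have "\<dots> \<le> (\<Sum>k\<in>index h. ws r k * total (index (g k)) (ws k))"
    using min_cost_le[OF is_bfun_inner restrict_in_cube u, of _ "\<lambda>_. 1"]
      family_nonneg[OF is_bfun_outer inner_values_in_cube w]
    by (intro sum_mono mult_left_mono) (auto simp: local_measure_eq_min_cost total_def)
  also have "\<dots> = total (leaves tree) (tree_weight tree ws)"
    using sum_tree_weight[of ws "\<lambda>_. 1"] by (simp add: total_def)
  also note total_le
  finally show "min_cost A h (inner_values h g z)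
      (\<lambda>k. local_measure A (g k) (restrict z (index (g k)))) \<le> local_measure A (graft h g) z"
    by (simp only: W(2))
qed

end


section \<open>Renaming of indices\<close>

definition relabel :: "('i \<Rightarrow> 'j) \<Rightarrow> 'i bfun \<Rightarrow> 'j bfun" where
  "relabel \<sigma> f =
     \<lparr> index = \<sigma> ` index f,
       eval = (\<lambda>z \<in> cube (\<sigma> ` index f). eval f (\<lambda>i \<in> index f. z (\<sigma> i))) \<rparr>"

definition id_bfun :: "'i \<Rightarrow> 'i bfun" where
  "id_bfun u = \<lparr> index = {u}, eval = (\<lambda>x \<in> cube {u}. x u) \<rparr>"

lemma index_relabel [simp]: "index (relabel \<sigma> f) = \<sigma> ` index f"
  by (simp add: relabel_def)

lemma is_bfun_relabel: "is_bfun f \<Longrightarrow> is_bfun (relabel \<sigma> f)"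
  by (simp add: relabel_def is_bfun_def)

lemma eval_relabel:
  "z \<in> cube (\<sigma> ` index f) \<Longrightarrow> eval (relabel \<sigma> f) z = eval f (\<lambda>i \<in> index f. z (\<sigma> i))"
  by (simp add: relabel_def)

lemma eval_relabel_restrict:
  "eval (relabel \<sigma> f) (restrict z (\<sigma> ` index f)) = eval f (\<lambda>i \<in> index f. z (\<sigma> i))"
  by (simp add: relabel_def cong: restrict_cong)

lemma relabel_relabel: "relabel \<rho> (relabel \<sigma> f) = relabel (\<rho> \<circ> \<sigma>) f"
  by (simp add: relabel_def image_image cong: restrict_cong)

lemma relabel_cong:
  assumes "\<And>i. i \<in> index f \<Longrightarrow> \<sigma> i = \<tau> i"
  shows "relabel \<sigma> f = relabel \<tau> f"
proof -
  have "(\<lambda>i\<in>index f. z (\<sigma> i)) = (\<lambda>i\<in>index f. z (\<tau> i))" for z :: "_ \<Rightarrow> bool"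
    using assms by (intro restrict_ext) simp
  moreover have "\<sigma> ` index f = \<tau> ` index f"
    using assms by (rule image_cong[OF refl])
  ultimately show ?thesis
    by (simp add: relabel_def)
qed

lemma relabel_id: "is_bfun f \<Longrightarrow> relabel id f = f"
  by (cases f) (simp add: relabel_def is_bfun_def extensional_restrict cong: restrict_cong)

lemma index_id_bfun [simp]: "index (id_bfun u) = {u}"
  by (simp add: id_bfun_def)

lemma is_bfun_id_bfun [simp]: "is_bfun (id_bfun u)"
  by (simp add: id_bfun_def is_bfun_def)

lemma eval_id_bfun: "x \<in> cube {u} \<Longrightarrow> eval (id_bfun u) x = x u"
  by (simp add: id_bfun_def)

lemma relabel_id_bfun: "relabel (\<lambda>_. t) (id_bfun s) = id_bfun t"
  by (auto simp: relabel_def id_bfun_def intro!: restrict_ext)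

lemma inner_values_id_bfun: "inner_values f (\<lambda>i. id_bfun (\<sigma> i)) z = (\<lambda>i\<in>index f. z (\<sigma> i))"
  by (simp add: inner_values_def eval_id_bfun)

lemma graft_id_bfun: "graft f (\<lambda>i. id_bfun (\<sigma> i)) = relabel \<sigma> f"
proof -
  have "(\<Union>i\<in>index f. {\<sigma> i}) = \<sigma> ` index f" by auto
  then show ?thesis
    by (simp add: graft_def relabel_def inner_values_id_bfun)
qed

lemma graftable_id_bfun:
  assumes "is_bfun f" "index f \<noteq> {}" "inj_on \<sigma> (index f)" "\<sigma> ` index f \<inter> index f = {}"
  shows "graftable f (\<lambda>i. id_bfun (\<sigma> i))"
  using assms by (auto simp: graftable_def disjoint_family_on_def inj_on_def)

lemma ex_inj_on_avoiding:
  assumes "infinite (UNIV :: 'b set)" "finite I" "finite S"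
  obtains c :: "'a \<Rightarrow> 'b" where "inj_on c I" "c ` I \<inter> S = {}"
proof -
  obtain B where B: "finite B" "card B = card I" "B \<subseteq> UNIV - S"
    using infinite_arbitrarily_large[of "UNIV - S"] assms by (metis Diff_infinite_finite)
  then obtain c where "bij_betw c I B"
    using assms(2) by (metis finite_same_card_bij)
  then show thesis
    using B(3) by (intro that[of c]) (auto simp: bij_betw_def)
qed

context compact_assemblage
begin

lemma min_cost_id_bfun:
  assumes "x \<in> cube {u}" "0 \<le> c u"
  shows "min_cost A (id_bfun u) x c = c u * local_measure A (id_bfun u) x"
proof -
  have "min_cost A (id_bfun u) x c = min_cost A (id_bfun u) x (\<lambda>_. c u * 1)"
    by (rule min_cost_cong) simp
  also have "\<dots> = c u * local_measure A (id_bfun u) x"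
    unfolding local_measure_eq_min_cost using assms by (intro min_cost_mult_left) auto
  finally show ?thesis .
qed

lemma local_measure_nonneg:
  assumes "is_bfun f" "x \<in> cube (index f)"
  shows "0 \<le> local_measure A f x"
  unfolding local_measure_eq_min_cost by (rule min_cost_nonneg[OF assms]) simp

end

context well_behaved_assemblage
begin

lemma local_measure_id_bfun_mult:
  assumes "s \<noteq> t"
  shows "local_measure A (id_bfun t) (\<lambda>_\<in>{t}. b) =
    local_measure A (id_bfun s) (\<lambda>_\<in>{s}. b) * local_measure A (id_bfun t) (\<lambda>_\<in>{t}. b)"
proof -
  let ?m = "\<lambda>u. local_measure A (id_bfun u) (\<lambda>_\<in>{u}. b)"
  have "?m t = local_measure A (graft (id_bfun s) (\<lambda>_. id_bfun t)) (\<lambda>_\<in>{t}. b)"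
    by (simp add: graft_id_bfun relabel_id_bfun)
  also have "\<dots> = min_cost A (id_bfun s) (\<lambda>_\<in>{s}. b) (\<lambda>_. ?m t)"
    using assms
    by (subst local_measure_graft)
      (auto intro: graftable_id_bfun simp: index_graft inner_values_id_bfun)
  also have "\<dots> = ?m s * ?m t"
    using local_measure_nonneg[of "id_bfun t"] by (simp add: min_cost_id_bfun)
  finally show ?thesis .
qed

text \<open>By \<open>local_measure_id_bfun_mult\<close>, \<open>m(t) = m(s) m(t) = m(s)\<close>, so this value is idempotent.\<close>

lemma local_measure_id_bfun_le_1:
  assumes "x \<in> cube {t}"
  shows "local_measure A (id_bfun t) x \<le> 1"
proof -
  obtain s where s: "s \<noteq> t"
    using infinite_labels by (metis ex_new_if_finite finite.emptyI finite_insert insertI1)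
  let ?m = "\<lambda>u. local_measure A (id_bfun u) (\<lambda>_\<in>{u}. x t)"
  have "?m t = ?m s * ?m t" "?m s = ?m t * ?m s"
    by (rule local_measure_id_bfun_mult, use s in simp)+
  then have "?m t = ?m t * ?m t"
    by (metis mult.commute)
  then have "?m t \<le> 1"
    by (metis mult_cancel_right1 order_refl zero_le_one)
  moreover have "(\<lambda>_\<in>{t}. x t) = x"
    using assms by (auto simp: cube_def fun_eq_iff PiE_iff extensional_def)
  ultimately show ?thesis by simp
qed

lemma min_cost_relabel_le_disjoint:
  assumes f: "is_bfun f" "index f \<noteq> {}" and \<sigma>: "inj_on \<sigma> (index f)" "\<sigma> ` index f \<inter> index f = {}"
    and z: "z \<in> cube (\<sigma> ` index f)" and cost_nonneg: "\<And>j. j \<in> \<sigma> ` index f \<Longrightarrow> 0 \<le> c j"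
  shows "min_cost A (relabel \<sigma> f) z c \<le> min_cost A f (\<lambda>i\<in>index f. z (\<sigma> i)) (\<lambda>i. c (\<sigma> i))"
proof -
  have "min_cost A (relabel \<sigma> f) z c \<le> min_cost A f (\<lambda>i\<in>index f. z (\<sigma> i))
      (\<lambda>i. min_cost A (id_bfun (\<sigma> i)) (restrict z {\<sigma> i}) c)"
    using min_cost_graft_le[OF graftable_id_bfun[OF f \<sigma>], of z c] z
    by (simp add: graft_id_bfun inner_values_id_bfun)
  also have "\<dots> \<le> min_cost A f (\<lambda>i\<in>index f. z (\<sigma> i)) (\<lambda>i. c (\<sigma> i))"
  proof (rule min_cost_mono[OF f(1) restrict_in_cube])
    fix i assume i: "i \<in> index f"
    then show "min_cost A (id_bfun (\<sigma> i)) (restrict z {\<sigma> i}) c \<le> c (\<sigma> i)"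
      using cost_nonneg local_measure_id_bfun_le_1[OF restrict_in_cube]
      by (simp add: min_cost_id_bfun mult_left_le)
  qed
  finally show ?thesis .
qed

lemma min_cost_relabel_le:
  assumes f: "is_bfun f" "index f \<noteq> {}" and \<sigma>: "inj_on \<sigma> (index f)"
    and z: "z \<in> cube (\<sigma> ` index f)" and cost_nonneg: "\<And>j. j \<in> \<sigma> ` index f \<Longrightarrow> 0 \<le> c j"
  shows "min_cost A (relabel \<sigma> f) z c \<le> min_cost A f (\<lambda>i\<in>index f. z (\<sigma> i)) (\<lambda>i. c (\<sigma> i))"
proof -
  let ?I = "index f"
  obtain \<tau> :: "'i \<Rightarrow> 'i" where \<tau>: "inj_on \<tau> ?I" "\<tau> ` ?I \<inter> (?I \<union> \<sigma> ` ?I) = {}"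
    using ex_inj_on_avoiding[OF infinite_labels, of ?I "?I \<union> \<sigma> ` ?I"]
      is_bfun_finite[OF f(1)] by auto
  define \<rho> where "\<rho> = \<sigma> \<circ> inv_into ?I \<tau>"
  have \<rho>: "\<rho> (\<tau> i) = \<sigma> i" if "i \<in> ?I" for i
    using that \<tau>(1) by (simp add: \<rho>_def)
  then have image_\<rho>: "\<rho> ` \<tau> ` ?I = \<sigma> ` ?I" by force
  have inj_\<rho>: "inj_on \<rho> (\<tau> ` ?I)"
    using \<sigma> \<rho> by (auto simp: inj_on_def)
  have restrict_\<rho>: "(\<lambda>i\<in>?I. restrict (\<lambda>k. z (\<rho> k)) (\<tau> ` ?I) (\<tau> i)) = (\<lambda>i\<in>?I. z (\<sigma> i))"
    by (intro restrict_ext) (simp add: \<rho>)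
  have "relabel \<sigma> f = relabel \<rho> (relabel \<tau> f)"
    unfolding relabel_relabel by (rule relabel_cong) (simp add: \<rho>)
  then have "min_cost A (relabel \<sigma> f) z c = min_cost A (relabel \<rho> (relabel \<tau> f)) z c"
    by simp
  also have "\<dots> \<le> min_cost A (relabel \<tau> f) (\<lambda>k\<in>\<tau> ` ?I. z (\<rho> k)) (\<lambda>k. c (\<rho> k))"
    using min_cost_relabel_le_disjoint[of "relabel \<tau> f" \<rho> z c] f \<tau>(2) z cost_nonneg inj_\<rho>
    by (simp add: is_bfun_relabel image_\<rho> Int_Un_distrib Int_commute)
  also have "\<dots> \<le> min_cost A f (\<lambda>i\<in>?I. z (\<sigma> i)) (\<lambda>i. c (\<rho> (\<tau> i)))"
    using min_cost_relabel_le_disjoint[OF f \<tau>(1), of "\<lambda>k\<in>\<tau> ` ?I. z (\<rho> k)" "\<lambda>k. c (\<rho> k)"]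
      \<tau>(2) cost_nonneg \<rho>
    unfolding restrict_\<rho> by (auto simp: Int_Un_distrib)
  also have "\<dots> = min_cost A f (\<lambda>i\<in>?I. z (\<sigma> i)) (\<lambda>i. c (\<sigma> i))"
    by (rule min_cost_cong) (simp add: \<rho>)
  finally show ?thesis .
qed

lemma min_cost_relabel:
  assumes f: "is_bfun f" "index f \<noteq> {}" and \<sigma>: "inj_on \<sigma> (index f)"
    and z: "z \<in> cube (\<sigma> ` index f)" and cost_nonneg: "\<And>j. j \<in> \<sigma> ` index f \<Longrightarrow> 0 \<le> c j"
  shows "min_cost A (relabel \<sigma> f) z c = min_cost A f (\<lambda>i\<in>index f. z (\<sigma> i)) (\<lambda>i. c (\<sigma> i))"
proof (rule antisym[OF min_cost_relabel_le[OF assms]])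
  let ?I = "index f" and ?\<tau> = "inv_into (index f) \<sigma>"
  have \<tau>: "?\<tau> (\<sigma> i) = i" if "i \<in> ?I" for i
    using \<sigma> that by simp
  then have image_\<tau>: "?\<tau> ` \<sigma> ` ?I = ?I" by force
  have "relabel (?\<tau> \<circ> \<sigma>) f = relabel id f"
    by (rule relabel_cong) (simp add: \<tau>)
  then have "relabel ?\<tau> (relabel \<sigma> f) = f"
    using f(1) by (simp add: relabel_relabel relabel_id)
  moreover have "(\<lambda>k\<in>\<sigma> ` ?I. restrict (\<lambda>i. z (\<sigma> i)) ?I (?\<tau> k)) = z"
  proof -
    have "(\<lambda>k\<in>\<sigma> ` ?I. restrict (\<lambda>i. z (\<sigma> i)) ?I (?\<tau> k)) = restrict z (\<sigma> ` ?I)"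
      by (rule restrict_ext) (auto simp: \<tau>)
    then show ?thesis using z by simp
  qed
  moreover have "inj_on ?\<tau> (\<sigma> ` ?I)"
    by (simp add: inj_on_inv_into)
  ultimately have "min_cost A f (\<lambda>i\<in>?I. z (\<sigma> i)) (\<lambda>i. c (\<sigma> i))
      \<le> min_cost A (relabel \<sigma> f) z (\<lambda>k. c (\<sigma> (?\<tau> k)))"
    using min_cost_relabel_le[of "relabel \<sigma> f" ?\<tau> "\<lambda>i\<in>?I. z (\<sigma> i)" "\<lambda>i. c (\<sigma> i)"] f cost_nonneg
    by (simp add: is_bfun_relabel image_\<tau>)
  also have "\<dots> = min_cost A (relabel \<sigma> f) z c"
    by (rule min_cost_cong) (auto simp: \<tau>)
  finally show "min_cost A f (\<lambda>i\<in>?I. z (\<sigma> i)) (\<lambda>i. c (\<sigma> i)) \<le> min_cost A (relabel \<sigma> f) z c" .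
qed

end


section \<open>Composition\<close>

lemma infinite_UNIV_label: "infinite (UNIV :: 'a label set)"
proof
  assume "finite (UNIV :: 'a label set)"
  then have "surj (Pr (Atom undefined :: 'a label))"
    by (intro finite_UNIV_inj_surj) (auto simp: inj_def)
  then show False by (metis label.distinct(1) surjD)
qed

definition block :: "'a label set \<Rightarrow> ('a label \<Rightarrow> bool) \<Rightarrow> 'a label \<Rightarrow> 'a label \<Rightarrow> bool" where
  "block J z i = (\<lambda>j\<in>J. z (Pr i j))"

definition block_values ::
    "'a label bfun \<Rightarrow> 'a label bfun \<Rightarrow> ('a label \<Rightarrow> bool) \<Rightarrow> 'a label \<Rightarrow> bool" where
  "block_values f g z = (\<lambda>i\<in>index f. eval g (block (index g) z i))"

lemma block_in_cube [simp]: "block J z i \<in> cube J"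
  by (simp add: block_def)

lemma block_values_in_cube [simp]: "block_values f g z \<in> cube (index f)"
  by (simp add: block_values_def)

lemma label_times_eq_image: "label_times I J = (\<lambda>(i, j). Pr i j) ` (I \<times> J)"
  by (auto simp: label_times_def)

lemma index_bfun_comp [simp]: "index (bfun_comp f g) = label_times (index f) (index g)"
  by (simp add: bfun_comp_def)

lemma is_bfun_comp: "is_bfun f \<Longrightarrow> is_bfun g \<Longrightarrow> is_bfun (bfun_comp f g)"
  by (simp add: is_bfun_def bfun_comp_def label_times_eq_image)

lemma eval_bfun_comp:
  "z \<in> cube (label_times (index f) (index g)) \<Longrightarrow>
    eval (bfun_comp f g) z = eval f (block_values f g z)"
  by (simp add: bfun_comp_def block_values_def block_def)

lemma ex_bfun_comp_input:
  assumes x: "x \<in> cube (index f)"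
    and y: "\<And>i. i \<in> index f \<Longrightarrow> y i \<in> cube (index g) \<and> eval g (y i) = x i"
  obtains z where "z \<in> cube (label_times (index f) (index g))"
    and "\<And>i. i \<in> index f \<Longrightarrow> block (index g) z i = y i" and "block_values f g z = x"
proof -
  define z where "z = (\<lambda>l \<in> label_times (index f) (index g).
    case l of Pr i j \<Rightarrow> y i j | Atom _ \<Rightarrow> undefined)"
  have blocks: "block (index g) z i = y i" if i: "i \<in> index f" for i
  proof -
    have "block (index g) z i = restrict (y i) (index g)"
      unfolding block_def z_def using i by (intro restrict_ext) (simp add: label_times_def)
    then show ?thesis using y[OF i] by simp
  qed
  have "block_values f g z = restrict x (index f)"
    unfolding block_values_def using y by (intro restrict_ext) (simp add: blocks)
  with blocks x show thesis
    by (intro that[of z]) (simp_all add: z_def)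
qed

lemma nonconstant_surj:
  assumes "nonconstant f"
  obtains x where "x \<in> cube (index f)" "eval f x = b"
  using assms unfolding nonconstant_def by (metis (full_types))

lemma nonconstant_index_nonempty: "nonconstant f \<Longrightarrow> index f \<noteq> {}"
  by (auto simp: nonconstant_def cube_def)

lemma nonconstant_comp:
  assumes f: "nonconstant f" and g: "nonconstant g"
  shows "nonconstant (bfun_comp f g)"
proof -
  have "\<exists>z \<in> cube (index (bfun_comp f g)). eval (bfun_comp f g) z = b" for b
  proof -
    obtain x where x: "x \<in> cube (index f)" "eval f x = b"
      by (rule nonconstant_surj[OF f])
    have "\<exists>y. y \<in> cube (index g) \<and> eval g y = x i" for i
      using nonconstant_surj[OF g] by metis
    then obtain y where "\<And>i. y i \<in> cube (index g) \<and> eval g (y i) = x i"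
      by metis
    then obtain z where "z \<in> cube (label_times (index f) (index g))" "block_values f g z = x"
      using ex_bfun_comp_input[OF x(1)] by metis
    then show ?thesis
      using x(2) by (intro bexI[of _ z]) (simp_all add: eval_bfun_comp)
  qed
  from this[of True] this[of False] show ?thesis
    unfolding nonconstant_def by metis
qed

text \<open>The nodes of a tree are distinct, so the indices of the outer function have to be moved away
  from those of the composition by means of \<open>c\<close>.\<close>

definition block_copies ::
    "'a label bfun \<Rightarrow> ('a label \<Rightarrow> 'i) \<Rightarrow> 'a label bfun \<Rightarrow> 'i \<Rightarrow> 'a label bfun" where
  "block_copies f c g k = relabel (Pr (inv_into (index f) c k)) g"

context
  fixes f g :: "'a label bfun" and c :: "'a label \<Rightarrow> 'i"
  assumes inj: "inj_on c (index f)"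
begin

lemma block_copies_image: "i \<in> index f \<Longrightarrow> block_copies f c g (c i) = relabel (Pr i) g"
  using inj by (simp add: block_copies_def)

lemma inner_values_block_copies:
  "(\<lambda>i\<in>index f. inner_values (relabel c f) (block_copies f c g) z (c i)) = block_values f g z"
  unfolding block_values_def
  by (rule restrict_ext)
    (simp add: inner_values_def block_copies_image eval_relabel_restrict block_def)

lemma graft_block_copies: "graft (relabel c f) (block_copies f c g) = bfun_comp f g"
proof -
  have "(\<Union>k\<in>c ` index f. index (block_copies f c g k)) = label_times (index f) (index g)"
    by (auto simp: block_copies_image label_times_def)
  moreover have "eval (relabel c f) (inner_values (relabel c f) (block_copies f c g) z)
      = eval f (block_values f g z)" for z
    by (simp add: eval_relabel[OF inner_values_in_cube[of "relabel c f", unfolded index_relabel]]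
        inner_values_block_copies)
  ultimately show ?thesis
    by (simp add: graft_def bfun_comp_def block_values_def block_def)
qed

end

lemma graftable_block_copies:
  assumes f: "is_bfun f" "index f \<noteq> {}" and g: "is_bfun g" "index g \<noteq> {}"
    and c: "inj_on c (index f)" "c ` index f \<inter> label_times (index f) (index g) = {}"
  shows "graftable (relabel c f) (block_copies f c g)"
  unfolding graftable_def disjoint_family_on_def using f g c(2)
  by (fastforce simp: block_copies_image[OF c(1)] is_bfun_relabel label_times_def)

locale well_behaved_label_assemblage = well_behaved_assemblage A for A :: "'a label family"
begin

lemma local_measure_bfun_comp:
  assumes f: "is_bfun f" "index f \<noteq> {}" and g: "is_bfun g" "index g \<noteq> {}"
    and z: "z \<in> cube (index (bfun_comp f g))"
  shows "local_measure A (bfun_comp f g) z =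
    min_cost A f (block_values f g z) (\<lambda>i. local_measure A g (block (index g) z i))"
proof -
  let ?I = "index f" and ?J = "index g"
  obtain c :: "'a label \<Rightarrow> 'a label" where c: "inj_on c ?I" "c ` ?I \<inter> label_times ?I ?J = {}"
    using ex_inj_on_avoiding[OF infinite_labels, of ?I "label_times ?I ?J"] is_bfun_finite[OF f(1)]
      is_bfun_finite[OF is_bfun_comp[OF f(1) g(1)]] by auto
  let ?h = "relabel c f" and ?g = "block_copies f c g"
  have "local_measure A (bfun_comp f g) z =
      min_cost A ?h (inner_values ?h ?g z) (\<lambda>k. local_measure A (?g k) (restrict z (index (?g k))))"
    using graftable_block_copies[OF f g c] z
    unfolding graft_block_copies[OF c(1), symmetric] by (rule local_measure_graft)
  also have "\<dots> = min_cost A f (block_values f g z)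
      (\<lambda>i. local_measure A (?g (c i)) (restrict z (index (?g (c i)))))"
    using min_cost_relabel[OF f c(1), of "inner_values ?h ?g z"]
      inner_values_in_cube[of ?h ?g z] inner_values_block_copies[OF c(1), of g z]
      local_measure_nonneg[OF is_bfun_relabel[OF g(1)] restrict_in_cube]
    by (simp add: block_copies_def)
  also have "\<dots> = min_cost A f (block_values f g z) (\<lambda>i. local_measure A g (block ?J z i))"
  proof (rule min_cost_cong)
    fix i assume "i \<in> ?I"
    then show "local_measure A (?g (c i)) (restrict z (index (?g (c i))))
        = local_measure A g (block ?J z i)"
      using min_cost_relabel[OF g, of "Pr i" "restrict z (Pr i ` ?J)" "\<lambda>_. 1"]
      by (simp add: block_copies_image[OF c(1)] local_measure_eq_min_cost block_def inj_on_def
          cong: restrict_cong)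
  qed
  finally show ?thesis .
qed

end


section \<open>The growth map\<close>

definition growth_map :: "'i family \<Rightarrow> 'i bfun \<Rightarrow> (bool \<Rightarrow> real) \<Rightarrow> bool \<Rightarrow> real" where
  "growth_map A f v b =
     Max ((\<lambda>x. min_cost A f x (\<lambda>i. v (x i))) ` {x \<in> cube (index f). eval f x = b})"

lemma bit_measure_eq_growth_map: "bit_measure A b f = growth_map A f (\<lambda>_. 1) b"
  by (simp add: bit_measure_def growth_map_def local_measure_eq_min_cost)

lemma finite_fibre: "is_bfun f \<Longrightarrow> finite {x \<in> cube (index f). eval f x = b}"
  by (simp add: finite_cube is_bfun_finite)

lemma min_cost_le_growth_map:
  assumes "is_bfun f" "x \<in> cube (index f)"
  shows "min_cost A f x (\<lambda>i. v (x i)) \<le> growth_map A f v (eval f x)"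
  unfolding growth_map_def using assms finite_fibre by (intro Max_ge) auto

lemma growth_map_le_iff:
  assumes "is_bfun f" "nonconstant f"
  shows "growth_map A f v b \<le> K \<longleftrightarrow>
    (\<forall>x\<in>cube (index f). eval f x = b \<longrightarrow> min_cost A f x (\<lambda>i. v (x i)) \<le> K)"
proof -
  obtain x where "x \<in> cube (index f)" "eval f x = b"
    by (rule nonconstant_surj[OF assms(2)])
  then show ?thesis
    unfolding growth_map_def using finite_fibre[OF assms(1)] by (subst Max_le_iff) auto
qed

lemma growth_map_attained:
  assumes "is_bfun f" "nonconstant f"
  obtains x where "x \<in> cube (index f)" "eval f x = b"
    "growth_map A f v b = min_cost A f x (\<lambda>i. v (x i))"
proof -
  obtain x where "x \<in> cube (index f)" "eval f x = b"
    by (rule nonconstant_surj[OF assms(2)])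
  then have "growth_map A f v b \<in>
      (\<lambda>x. min_cost A f x (\<lambda>i. v (x i))) ` {x \<in> cube (index f). eval f x = b}"
    unfolding growth_map_def using finite_fibre[OF assms(1)] by (intro Max_in) auto
  then show thesis using that by auto
qed

context compact_assemblage
begin

lemma mono_growth_map:
  assumes f: "is_bfun f" "nonconstant f"
  shows "mono (growth_map A f)"
proof (rule monoI, rule le_funI)
  fix u v :: "bool \<Rightarrow> real" and b assume uv: "u \<le> v"
  show "growth_map A f u b \<le> growth_map A f v b"
    unfolding growth_map_le_iff[OF f]
  proof (intro ballI impI)
    fix x assume x: "x \<in> cube (index f)" "eval f x = b"
    have "min_cost A f x (\<lambda>i. u (x i)) \<le> min_cost A f x (\<lambda>i. v (x i))"
      using uv by (intro min_cost_mono[OF f(1) x(1)]) (simp add: le_fun_def)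
    also have "\<dots> \<le> growth_map A f v b"
      unfolding x(2)[symmetric] by (rule min_cost_le_growth_map[OF f(1) x(1)])
    finally show "min_cost A f x (\<lambda>i. u (x i)) \<le> growth_map A f v b" .
  qed
qed

lemma growth_map_mult_left:
  assumes f: "is_bfun f" "nonconstant f" and k: "0 \<le> k"
  shows "growth_map A f (\<lambda>b. k * v b) = (\<lambda>b. k * growth_map A f v b)"
proof (rule ext, rule antisym)
  fix b
  show "growth_map A f (\<lambda>b. k * v b) b \<le> k * growth_map A f v b"
    unfolding growth_map_le_iff[OF f]
    using min_cost_le_growth_map[OF f(1), of _ A v] k
    by (auto simp: min_cost_mult_left[OF f(1)] intro!: mult_left_mono)
  obtain x where x: "x \<in> cube (index f)" "eval f x = b"
    "growth_map A f v b = min_cost A f x (\<lambda>i. v (x i))"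
    by (rule growth_map_attained[OF f])
  then show "k * growth_map A f v b \<le> growth_map A f (\<lambda>b. k * v b) b"
    using min_cost_le_growth_map[OF f(1) x(1), of A "\<lambda>b. k * v b"] k
    by (simp add: min_cost_mult_left[OF f(1)])
qed

end

lemma is_bfun_pow: "is_bfun f \<Longrightarrow> is_bfun (bfun_pow f (Suc n))"
  by (induction n) (auto intro: is_bfun_comp)

lemma nonconstant_pow: "nonconstant f \<Longrightarrow> nonconstant (bfun_pow f (Suc n))"
  by (induction n) (auto intro: nonconstant_comp)

lemma local_measure_le_bit_measure:
  "is_bfun f \<Longrightarrow> x \<in> cube (index f) \<Longrightarrow> local_measure A f x \<le> bit_measure A (eval f x) f"
  unfolding local_measure_eq_min_cost bit_measure_eq_growth_map
  by (rule min_cost_le_growth_map[where v = "\<lambda>_. 1"])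

lemma bit_measure_attained:
  assumes "is_bfun f" "nonconstant f"
  obtains x where "x \<in> cube (index f)" "eval f x = b" "bit_measure A b f = local_measure A f x"
  unfolding local_measure_eq_min_cost bit_measure_eq_growth_map
  by (rule growth_map_attained[OF assms, where A = A and v = "\<lambda>_. 1"])

context well_behaved_label_assemblage
begin

context
  fixes f g :: "'a label bfun"
  assumes f: "is_bfun f" "nonconstant f" and g: "is_bfun g" "nonconstant g"
begin

lemma local_measure_bfun_comp_le_growth_map:
  assumes z: "z \<in> cube (index (bfun_comp f g))"
  shows "local_measure A (bfun_comp f g) z
    \<le> growth_map A f (\<lambda>t. bit_measure A t g) (eval (bfun_comp f g) z)"
proof -
  let ?x = "block_values f g z"
  have "local_measure A (bfun_comp f g) z
      = min_cost A f ?x (\<lambda>i. local_measure A g (block (index g) z i))"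
    using f g z by (intro local_measure_bfun_comp nonconstant_index_nonempty)
  also have "\<dots> \<le> min_cost A f ?x (\<lambda>i. bit_measure A (?x i) g)"
    using local_measure_le_bit_measure[OF g(1) block_in_cube]
    by (intro min_cost_mono[OF f(1) block_values_in_cube]) (simp add: block_values_def)
  also have "\<dots> \<le> growth_map A f (\<lambda>t. bit_measure A t g) (eval f ?x)"
    by (rule min_cost_le_growth_map[OF f(1) block_values_in_cube,
          where v = "\<lambda>t. bit_measure A t g"])
  finally show ?thesis
    using z by (simp add: eval_bfun_comp)
qed

lemma growth_map_le_bit_measure_bfun_comp:
  "growth_map A f (\<lambda>t. bit_measure A t g) b \<le> bit_measure A b (bfun_comp f g)"
proof -
  obtain x where x: "x \<in> cube (index f)" "eval f x = b"
    "growth_map A f (\<lambda>t. bit_measure A t g) b = min_cost A f x (\<lambda>i. bit_measure A (x i) g)"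
    by (rule growth_map_attained[OF f])
  have "\<exists>y. y \<in> cube (index g) \<and> eval g y = t \<and> bit_measure A t g = local_measure A g y" for t
    by (rule bit_measure_attained[OF g, where A = A and b = t]) blast
  then obtain y where y: "\<And>t. y t \<in> cube (index g)" "\<And>t. eval g (y t) = t"
    "\<And>t. bit_measure A t g = local_measure A g (y t)"
    by metis
  obtain z where z: "z \<in> cube (index (bfun_comp f g))" "block_values f g z = x"
    and blocks: "\<And>i. i \<in> index f \<Longrightarrow> block (index g) z i = y (x i)"
    using ex_bfun_comp_input[OF x(1), of "\<lambda>i. y (x i)" g] y by auto
  have "growth_map A f (\<lambda>t. bit_measure A t g) b
      = min_cost A f (block_values f g z) (\<lambda>i. local_measure A g (block (index g) z i))"
    unfolding x(3) z(2) by (rule min_cost_cong) (simp add: y(3) blocks)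
  also have "\<dots> = local_measure A (bfun_comp f g) z"
    using f g z(1) by (intro local_measure_bfun_comp[symmetric] nonconstant_index_nonempty)
  also have "\<dots> \<le> bit_measure A b (bfun_comp f g)"
    using local_measure_le_bit_measure[OF is_bfun_comp[OF f(1) g(1)] z(1), of A] z x(2)
    by (simp add: eval_bfun_comp)
  finally show ?thesis .
qed

lemma bit_measure_bfun_comp:
  "bit_measure A b (bfun_comp f g) = growth_map A f (\<lambda>t. bit_measure A t g) b"
proof (rule antisym[OF _ growth_map_le_bit_measure_bfun_comp])
  obtain z where z: "z \<in> cube (index (bfun_comp f g))" "eval (bfun_comp f g) z = b"
    "bit_measure A b (bfun_comp f g) = local_measure A (bfun_comp f g) z"
    by (rule bit_measure_attained[OF is_bfun_comp[OF f(1) g(1)] nonconstant_comp[OF f(2) g(2)]])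
  show "bit_measure A b (bfun_comp f g) \<le> growth_map A f (\<lambda>t. bit_measure A t g) b"
    using local_measure_bfun_comp_le_growth_map[OF z(1)] unfolding z(2,3) .
qed

end

lemma bit_measure_pow:
  assumes f: "is_bfun f" "nonconstant f"
  shows "bit_measure A b (bfun_pow f (Suc n)) = (growth_map A f ^^ Suc n) (\<lambda>_. 1) b"
proof (induction n arbitrary: b)
  case 0
  then show ?case by (simp add: bit_measure_eq_growth_map)
next
  case (Suc n)
  have "bit_measure A b (bfun_pow f (Suc (Suc n)))
      = growth_map A f (\<lambda>t. bit_measure A t (bfun_pow f (Suc n))) b"
    using bit_measure_bfun_comp[OF f is_bfun_pow[OF f(1)] nonconstant_pow[OF f(2)]] by simp
  then show ?case
    by (simp add: Suc.IH)
qed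

end


section \<open>Nonnegative matrices indexed by bits\<close>

context
  fixes M :: "complex mat" and n :: nat
  assumes M: "M \<in> carrier_mat n n" "0 < n"
begin

lemma spectral_radius_eigenvalue:
  obtains z where "eigenvalue M z" "spectral_radius M = cmod z"
  using spectral_radius_mem_max(1)[OF M] by (auto simp: spectrum_def)

lemma cmod_eigenvalue_le_spectral_radius: "eigenvalue M z \<Longrightarrow> cmod z \<le> spectral_radius M"
  using spectral_radius_mem_max(2)[OF M] by (simp add: spectrum_def)

lemma spectral_radius_nonneg: "0 \<le> spectral_radius M"
  using spectral_radius_eigenvalue by (metis norm_ge_zero)

end

lemma det_mat_2:
  "det (mat 2 2 M) = M (0, 0) * M (1, 1) - M (0, 1) * (M (1, 0) :: 'a :: comm_ring_1)"
proof -
  have "det (mat 2 2 M) = (\<Sum>j<2. M (0, j) * cofactor (mat 2 2 M) 0 j)"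
    by (subst laplace_expansion_row[of _ 2 0]) auto
  also have "\<dots> = M (0, 0) * M (1, 1) - M (0, 1) * M (1, 0)"
    by (simp add: numeral_2_eq_2 cofactor_def det_single mat_delete_def)
  finally show ?thesis .
qed

lemma eigenvalue_mat_2_iff:
  fixes M :: "nat \<times> nat \<Rightarrow> 'a :: field"
  shows "eigenvalue (mat 2 2 M) z \<longleftrightarrow> (z - M (0, 0)) * (z - M (1, 1)) = M (0, 1) * M (1, 0)"
proof -
  have "char_matrix (mat 2 2 M) z = mat 2 2 (\<lambda>(i, j). M (i, j) - (if i = j then z else 0))"
    by (intro eq_matI) (auto simp: char_matrix_def)
  then have "eigenvalue (mat 2 2 M) z \<longleftrightarrow> (M (0, 0) - z) * (M (1, 1) - z) - M (0, 1) * M (1, 0) = 0"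
    by (subst eigenvalue_det[of _ 2]) (auto simp: det_mat_2)
  then show ?thesis
    by (simp add: algebra_simps)
qed

definition bit_mat :: "(bool \<Rightarrow> bool \<Rightarrow> real) \<Rightarrow> complex mat" where
  "bit_mat P = mat 2 2 (\<lambda>(s, t). complex_of_real (P (s = 1) (t = 1)))"

lemma bit_mat_carrier: "bit_mat P \<in> carrier_mat 2 2"
  by (simp add: bit_mat_def)

lemma eigenvalue_bit_mat_iff:
  "eigenvalue (bit_mat P) z \<longleftrightarrow>
    (z - of_real (P False False)) * (z - of_real (P True True)) =
      of_real (P False True * P True False)"
  by (simp add: bit_mat_def eigenvalue_mat_2_iff)

lemma spectral_radius_bit_mat_le:
  assumes P: "\<And>s t. 0 \<le> P s t" and v: "\<And>s. 0 < v s"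
    and sub: "\<And>s. (\<Sum>t\<in>UNIV. P s t * v t) \<le> \<kappa> * v s"
  shows "spectral_radius (bit_mat P) \<le> \<kappa>"
proof (rule ccontr)
  let ?a = "P False False" and ?b = "P False True" and ?c = "P True False" and ?d = "P True True"
  assume "\<not> spectral_radius (bit_mat P) \<le> \<kappa>"
  moreover obtain z where z: "eigenvalue (bit_mat P) z" "spectral_radius (bit_mat P) = cmod z"
    by (rule spectral_radius_eigenvalue[OF bit_mat_carrier pos2])
  ultimately have \<kappa>: "\<kappa> < cmod z" by simp
  have row_False: "?b * v True \<le> (\<kappa> - ?a) * v False"
    and row_True: "?c * v False \<le> (\<kappa> - ?d) * v True"
    using sub[of False] sub[of True] by (simp_all add: UNIV_bool algebra_simps)
  have "0 \<le> (\<kappa> - ?a) * v False" "0 \<le> (\<kappa> - ?d) * v True"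
    using order_trans[OF mult_nonneg_nonneg row_False] order_trans[OF mult_nonneg_nonneg row_True]
    by (simp_all add: P less_imp_le[OF v])
  then have diagonal: "?a \<le> \<kappa>" "?d \<le> \<kappa>"
    using v[of False] v[of True] by (auto simp: zero_le_mult_iff)
  have "?b * ?c * (v False * v True) = (?b * v True) * (?c * v False)"
    by simp
  also have "\<dots> \<le> ((\<kappa> - ?a) * v False) * ((\<kappa> - ?d) * v True)"
    using P v diagonal by (intro mult_mono row_False row_True) (simp_all add: less_imp_le)
  also have "\<dots> = (\<kappa> - ?a) * (\<kappa> - ?d) * (v False * v True)"
    by simp
  finally have "?b * ?c \<le> (\<kappa> - ?a) * (\<kappa> - ?d)"
    using v by (simp add: mult_le_cancel_right_pos)
  also have "\<dots> < (cmod z - ?a) * (cmod z - ?d)"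
    using diagonal \<kappa> by (intro mult_strict_mono') auto
  also have "\<dots> \<le> cmod (z - of_real ?a) * cmod (z - of_real ?d)"
    using diagonal \<kappa> P norm_triangle_ineq2[of z "of_real ?a"] norm_triangle_ineq2[of z "of_real ?d"]
    by (intro mult_mono) auto
  also have "\<dots> = ?b * ?c"
    using z(1) P by (simp add: eigenvalue_bit_mat_iff norm_mult[symmetric] del: of_real_mult)
  finally show False by simp
qed

lemma spectral_radius_bit_mat_less:
  assumes P: "\<And>s t. 0 \<le> P s t" and less: "spectral_radius (bit_mat P) < \<kappa>"
  shows "P s s < \<kappa>"
    and "P False True * P True False < (\<kappa> - P False False) * (\<kappa> - P True True)"
proof -
  let ?a = "P False False" and ?b = "P False True" and ?c = "P True False" and ?d = "P True True"
  define D where "D = sqrt ((?a - ?d)\<^sup>2 + 4 * ?b * ?c)"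
  define \<mu> where "\<mu> = (?a + ?d + D) / 2"
  have "D\<^sup>2 = (?a - ?d)\<^sup>2 + 4 * ?b * ?c"
    using P by (simp add: D_def)
  then have root: "(\<mu> - ?a) * (\<mu> - ?d) = ?b * ?c"
    unfolding \<mu>_def by (simp add: field_simps power2_eq_square)
  then have "eigenvalue (bit_mat P) (of_real \<mu>)"
    unfolding eigenvalue_bit_mat_iff by (simp flip: of_real_diff of_real_mult)
  from cmod_eigenvalue_le_spectral_radius[OF bit_mat_carrier pos2 this] have \<mu>: "\<mu> < \<kappa>"
    using less by simp
  have "\<bar>?a - ?d\<bar> \<le> D"
    unfolding D_def by (rule real_le_rsqrt) (use P in simp)
  then have diagonal: "P s s \<le> \<mu>" for s
    by (cases s) (auto simp: \<mu>_def abs_le_iff)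
  show "P s s < \<kappa>"
    using diagonal[of s] \<mu> by simp
  show "?b * ?c < (\<kappa> - ?a) * (\<kappa> - ?d)"
    unfolding root[symmetric] using diagonal[of False] diagonal[of True] \<mu>
    by (intro mult_strict_mono') auto
qed

lemma ex_subinvariant_bit_mat:
  assumes P: "\<And>s t. 0 \<le> P s t" and less: "spectral_radius (bit_mat P) < \<kappa>"
  obtains v where "\<And>s. 0 < v s" "\<And>s. (\<Sum>t\<in>UNIV. P s t * v t) \<le> \<kappa> * v s"
proof -
  \<comment> \<open>With this vector, each of the two rows amounts to \<open>gap\<close>.\<close>
  let ?v = "\<lambda>s. P s (\<not> s) + (\<kappa> - P (\<not> s) (\<not> s))"
  have gap: "P False True * P True False \<le> (\<kappa> - P False False) * (\<kappa> - P True True)"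
    using spectral_radius_bit_mat_less(2)[OF assms] by simp
  show thesis
  proof (rule that)
    show "0 < ?v s" for s
      using P spectral_radius_bit_mat_less(1)[OF assms] by (simp add: add_nonneg_pos)
    show "(\<Sum>t\<in>UNIV. P s t * ?v t) \<le> \<kappa> * ?v s" for s
      using gap by (cases s) (simp_all add: UNIV_bool algebra_simps)
  qed
qed


section \<open>Selector values\<close>

definition profile ::
    "'i set \<Rightarrow> (bool \<Rightarrow> 'i \<Rightarrow> bool) \<Rightarrow> (bool \<Rightarrow> 'i \<Rightarrow> real) \<Rightarrow> bool \<Rightarrow> bool \<Rightarrow> real" where
  "profile I \<alpha> w s t = (\<Sum>j\<in>{j \<in> I. \<alpha> s j = t}. w s j)"

lemma profile_matrix_eq_bit_mat: "profile_matrix I \<alpha> w = bit_mat (profile I \<alpha> w)"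
  by (simp add: profile_matrix_def bit_mat_def profile_def)

lemma sum_profile_mult:
  assumes "finite I"
  shows "(\<Sum>t\<in>UNIV. profile I \<alpha> w s t * v t) = (\<Sum>i\<in>I. w s i * v (\<alpha> s i))"
proof -
  have "(\<Sum>t\<in>UNIV. profile I \<alpha> w s t * v t)
      = (\<Sum>t\<in>UNIV. \<Sum>j\<in>{j \<in> I. \<alpha> s j = t}. w s j * v (\<alpha> s j))"
    by (simp add: profile_def sum_distrib_right)
  also have "\<dots> = (\<Sum>i\<in>I. w s i * v (\<alpha> s i))"
    using assms by (intro sum.group) auto
  finally show ?thesis .
qed

lemma compatible_selector_cube: "compatible_selector f \<alpha> \<Longrightarrow> \<alpha> b \<in> cube (index f)"
  and compatible_selector_eval: "compatible_selector f \<alpha> \<Longrightarrow> eval f (\<alpha> b) = b"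
  by (simp_all add: compatible_selector_def)

context compact_assemblage
begin

context
  fixes f :: "'i bfun" and \<alpha> :: "bool \<Rightarrow> 'i \<Rightarrow> bool"
  assumes f: "is_bfun f" and \<alpha>: "\<And>b. \<alpha> b \<in> cube (index f)"
begin

lemma profile_nonneg:
  assumes "\<And>b. w b \<in> A f (\<alpha> b)"
  shows "0 \<le> profile (index f) \<alpha> w s t"
  unfolding profile_def using family_nonneg[OF f \<alpha> assms] by (auto intro: sum_nonneg)

lemma ex_selector_weights: "\<exists>w. \<forall>b. w b \<in> A f (\<alpha> b)"
  using family_nonempty[OF f \<alpha>] by (intro choice) blast

lemma selector_value_nonneg: "0 \<le> selector_value A f \<alpha>"
  unfolding selector_value_def profile_matrix_eq_bit_mat
  using ex_selector_weights spectral_radius_nonneg[OF bit_mat_carrier pos2]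
  by (intro cInf_greatest) auto

lemma selector_value_le:
  assumes "\<And>b. w b \<in> A f (\<alpha> b)"
  shows "selector_value A f \<alpha> \<le> spectral_radius (bit_mat (profile (index f) \<alpha> w))"
  unfolding selector_value_def profile_matrix_eq_bit_mat
  using assms spectral_radius_nonneg[OF bit_mat_carrier pos2]
  by (intro cInf_lower bdd_belowI[of _ 0]) auto

lemma selector_value_le_of_subinvariant:
  assumes v: "\<And>b. 0 < v b" and sub: "\<And>b. min_cost A f (\<alpha> b) (\<lambda>i. v (\<alpha> b i)) \<le> \<kappa> * v b"
  shows "selector_value A f \<alpha> \<le> \<kappa>"
proof -
  have "\<exists>w. w \<in> A f (\<alpha> b) \<and> (\<Sum>i\<in>index f. w i * v (\<alpha> b i)) \<le> \<kappa> * v b" for b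
    using min_cost_attained[OF f \<alpha>] sub by metis
  then obtain w where w: "w b \<in> A f (\<alpha> b)" "(\<Sum>i\<in>index f. w b i * v (\<alpha> b i)) \<le> \<kappa> * v b" for b
    by metis
  have "selector_value A f \<alpha> \<le> spectral_radius (bit_mat (profile (index f) \<alpha> w))"
    using w(1) by (rule selector_value_le)
  also have "\<dots> \<le> \<kappa>"
    using profile_nonneg[OF w(1)] v w(2)
    by (intro spectral_radius_bit_mat_le[where v = v])
      (simp_all only: sum_profile_mult[OF is_bfun_finite[OF f]])
  finally show ?thesis .
qed

lemma ex_subinvariant_of_selector_value_less:
  assumes "selector_value A f \<alpha> < \<kappa>"
  obtains v where "\<And>b. 0 < v b" "\<And>b. min_cost A f (\<alpha> b) (\<lambda>i. v (\<alpha> b i)) \<le> \<kappa> * v b"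
proof -
  obtain w where w: "\<And>b. w b \<in> A f (\<alpha> b)"
    and less: "spectral_radius (bit_mat (profile (index f) \<alpha> w)) < \<kappa>"
    using cInf_lessD[OF _ assms[unfolded selector_value_def profile_matrix_eq_bit_mat]]
      ex_selector_weights by auto
  obtain v where v: "\<And>s. 0 < v s"
    and sub: "\<And>s. (\<Sum>t\<in>UNIV. profile (index f) \<alpha> w s t * v t) \<le> \<kappa> * v s"
    using ex_subinvariant_bit_mat[OF profile_nonneg[OF w] less] by blast
  have "min_cost A f (\<alpha> b) (\<lambda>i. v (\<alpha> b i)) \<le> \<kappa> * v b" for b
    using min_cost_le[OF f \<alpha> w, of b "\<lambda>i. v (\<alpha> b i)"] sub[of b]
    by (simp only: sum_profile_mult[OF is_bfun_finite[OF f]])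
  with v show thesis by (rule that)
qed

lemma ex_superinvariant_row:
  assumes less: "\<kappa> < selector_value A f \<alpha>" and v: "\<And>b. 0 \<le> v b"
  obtains b where "\<kappa> * v b \<le> min_cost A f (\<alpha> b) (\<lambda>i. v (\<alpha> b i))"
proof -
  have False if violated: "\<And>b. min_cost A f (\<alpha> b) (\<lambda>i. v (\<alpha> b i)) < \<kappa> * v b"
  proof -
    have "0 \<le> min_cost A f (\<alpha> b) (\<lambda>i. v (\<alpha> b i))" for b
      using v by (rule min_cost_nonneg[OF f \<alpha>])
    with violated have "v b \<noteq> 0" for b
      by (metis less_le_not_le mult_zero_right)
    then have "selector_value A f \<alpha> \<le> \<kappa>"
      using v violated by (intro selector_value_le_of_subinvariant[of v]) (auto simp: less_le)
    with less show False by simp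
  qed
  then show thesis
    using that not_le by blast
qed

text \<open>On the segment of vectors \<open>(1 - \<theta>, \<theta>)\<close>, the closed sets of \<open>\<theta>\<close> at which row 0 and row 1 are
  superinvariant cover everything. Each of them contains the endpoint at which the coordinate of its
  row vanishes, so by connectedness they meet.\<close>

lemma ex_superinvariant_vector:
  assumes less: "\<kappa> < selector_value A f \<alpha>"
  obtains v where "\<And>b. 0 \<le> v b" "v False + v True = 1"
    "\<And>b. \<kappa> * v b \<le> min_cost A f (\<alpha> b) (\<lambda>i. v (\<alpha> b i))"
proof -
  define v :: "real \<Rightarrow> bool \<Rightarrow> real" where "v = (\<lambda>\<theta> b. if b then \<theta> else 1 - \<theta>)"
  define K where "K = (\<lambda>b. {\<theta> \<in> {0..1}. \<kappa> * v \<theta> b \<le> min_cost A f (\<alpha> b) (\<lambda>i. v \<theta> (\<alpha> b i))})"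
  have v_nonneg: "0 \<le> v \<theta> b" if "\<theta> \<in> {0..1}" for \<theta> b
    using that by (simp add: v_def)
  have continuous_v: "continuous_on UNIV (\<lambda>\<theta>. v \<theta> b)" for b
    unfolding v_def by (cases b) (auto intro: continuous_intros)
  have "K b = {0..1} \<inter>
      (\<Inter>w\<in>A f (\<alpha> b). {\<theta>. \<kappa> * v \<theta> b \<le> (\<Sum>i\<in>index f. w i * v \<theta> (\<alpha> b i))})" for b
    unfolding K_def le_min_cost_iff[OF f \<alpha>] by auto
  then have closed_K: "closed (K b)" for b
    using continuous_v
    by (auto intro!: closed_INT closed_Collect_le continuous_intros)
  have cover: "{0..1} \<subseteq> K False \<union> K True"
  proof
    fix \<theta> :: real assume \<theta>: "\<theta> \<in> {0..1}"
    obtain b where "\<kappa> * v \<theta> b \<le> min_cost A f (\<alpha> b) (\<lambda>i. v \<theta> (\<alpha> b i))"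
      by (rule ex_superinvariant_row[where v = "v \<theta>", OF less v_nonneg[OF \<theta>]])
    with \<theta> have "\<theta> \<in> K b"
      by (simp add: K_def)
    then show "\<theta> \<in> K False \<union> K True"
      by (cases b) simp_all
  qed
  have "1 \<in> K False" "0 \<in> K True"
    using min_cost_nonneg[OF f \<alpha>] by (auto simp: K_def v_def)
  then have "K False \<inter> K True \<inter> {0..1} \<noteq> {}"
    using connected_closedD[OF connected_Icc _ cover closed_K closed_K] by fastforce
  then obtain \<theta> where \<theta>: "\<theta> \<in> {0..1}" "\<theta> \<in> K b" for b
    by (metis (full_types) IntE ex_in_conv)
  show thesis
  proof (rule that)
    show "\<kappa> * v \<theta> b \<le> min_cost A f (\<alpha> b) (\<lambda>i. v \<theta> (\<alpha> b i))" for b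
      using \<theta>(2)[of b] by (simp add: K_def)
  qed (use v_nonneg[OF \<theta>(1)] in \<open>simp_all add: v_def\<close>)
qed

end

end

lemma finite_compatible_selectors:
  assumes "is_bfun f"
  shows "finite {\<alpha>. compatible_selector f \<alpha>}"
proof (rule finite_subset)
  show "{\<alpha>. compatible_selector f \<alpha>} \<subseteq> UNIV \<rightarrow>\<^sub>E cube (index f)"
    by (auto simp: compatible_selector_def)
  show "finite (UNIV \<rightarrow>\<^sub>E cube (index f) :: (bool \<Rightarrow> _) set)"
    using assms by (simp add: finite_PiE finite_cube is_bfun_finite)
qed

lemma ex_compatible_selector:
  assumes "nonconstant f"
  shows "\<exists>\<alpha>. compatible_selector f \<alpha>"
  unfolding compatible_selector_def by (intro choice) (meson nonconstant_surj[OF assms])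

lemma selector_value_le_characteristic_value:
  assumes "is_bfun f" "compatible_selector f \<alpha>"
  shows "selector_value A f \<alpha> \<le> characteristic_value A f"
  unfolding characteristic_value_def using assms finite_compatible_selectors by (intro Max_ge) auto

lemma characteristic_value_attained:
  assumes "is_bfun f" "nonconstant f"
  obtains \<alpha> where "compatible_selector f \<alpha>" "characteristic_value A f = selector_value A f \<alpha>"
proof -
  have "characteristic_value A f \<in> selector_value A f ` {\<alpha>. compatible_selector f \<alpha>}"
    unfolding characteristic_value_def
    using assms finite_compatible_selectors ex_compatible_selector by (intro Max_in) auto
  then show thesis using that by blast
qed

definition bit_vector :: "real \<Rightarrow> bool \<Rightarrow> real" where
  "bit_vector t b = (if b then t else 1)"

definition subinvariant_at ::
    "'i family \<Rightarrow> 'i bfun \<Rightarrow> real \<Rightarrow> real \<Rightarrow> ('i \<Rightarrow> bool) \<Rightarrow> bool" where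
  "subinvariant_at A f \<kappa> t x \<longleftrightarrow>
     min_cost A f x (\<lambda>i. bit_vector t (x i)) \<le> \<kappa> * bit_vector t (eval f x)"

lemma finite_minimax_common_point:
  fixes P :: "'x \<Rightarrow> 't :: linorder \<Rightarrow> bool" and Q :: "'y \<Rightarrow> 't \<Rightarrow> bool"
  assumes finite: "finite X" "X \<noteq> {}" "finite Y" "Y \<noteq> {}"
    and pairwise: "\<And>x y. x \<in> X \<Longrightarrow> y \<in> Y \<Longrightarrow> \<exists>t\<in>T. P x t \<and> Q y t"
    and P_down: "\<And>x s t. x \<in> X \<Longrightarrow> s \<in> T \<Longrightarrow> s \<le> t \<Longrightarrow> P x t \<Longrightarrow> P x s"
    and Q_up: "\<And>y s t. y \<in> Y \<Longrightarrow> s \<in> T \<Longrightarrow> s \<le> t \<Longrightarrow> Q y s \<Longrightarrow> Q y t"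
  shows "\<exists>t\<in>T. (\<forall>x\<in>X. P x t) \<and> (\<forall>y\<in>Y. Q y t)"
proof -
  obtain \<tau> where \<tau>: "\<And>x y. x \<in> X \<Longrightarrow> y \<in> Y \<Longrightarrow> \<tau> x y \<in> T \<and> P x (\<tau> x y) \<and> Q y (\<tau> x y)"
    using pairwise by metis
  define m where "m = (\<lambda>x. Max (\<tau> x ` Y))"
  have m_attained: "m x \<in> \<tau> x ` Y" for x
    unfolding m_def using finite by (intro Max_in) auto
  have "Min (m ` X) \<in> m ` X"
    using finite by (intro Min_in) auto
  then obtain x\<^sub>0 where x\<^sub>0: "x\<^sub>0 \<in> X" "Min (m ` X) = m x\<^sub>0"
    by blast
  have in_T: "m x\<^sub>0 \<in> T"
    using m_attained[of x\<^sub>0] x\<^sub>0(1) \<tau> by auto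
  have "P x (m x\<^sub>0)" if "x \<in> X" for x
  proof (rule P_down[OF that in_T])
    show "m x\<^sub>0 \<le> m x"
      unfolding x\<^sub>0(2)[symmetric] using finite that by (intro Min_le) auto
    show "P x (m x)"
      using m_attained[of x] that \<tau> by auto
  qed
  moreover have "Q y (m x\<^sub>0)" if "y \<in> Y" for y
  proof (rule Q_up[OF that])
    show "\<tau> x\<^sub>0 y \<in> T" "Q y (\<tau> x\<^sub>0 y)"
      using \<tau>[OF x\<^sub>0(1) that] by auto
    show "\<tau> x\<^sub>0 y \<le> m x\<^sub>0"
      unfolding m_def using finite that by (intro Max_ge) auto
  qed
  ultimately show ?thesis
    using in_T by blast
qed

context compact_assemblage
begin

lemma characteristic_value_nonneg:
  assumes f: "is_bfun f" "nonconstant f"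
  shows "0 \<le> characteristic_value A f"
proof -
  obtain \<alpha> where "compatible_selector f \<alpha>" "characteristic_value A f = selector_value A f \<alpha>"
    by (rule characteristic_value_attained[OF f])
  then show ?thesis
    by (simp add: selector_value_nonneg f(1) compatible_selector_cube)
qed

lemma ex_subinvariant_at_selector:
  assumes f: "is_bfun f" and \<alpha>: "compatible_selector f \<alpha>" and less: "selector_value A f \<alpha> < \<kappa>"
  obtains t where "0 < t" "\<And>b. subinvariant_at A f \<kappa> t (\<alpha> b)"
proof -
  note cube = compatible_selector_cube[OF \<alpha>]
  obtain u where u: "\<And>b. 0 < u b" "\<And>b. min_cost A f (\<alpha> b) (\<lambda>i. u (\<alpha> b i)) \<le> \<kappa> * u b"
    using ex_subinvariant_of_selector_value_less[where \<alpha> = \<alpha>, OF f cube less] by blast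
  define t where "t = u True / u False"
  have u_eq: "u b = u False * bit_vector t b" for b
    using u(1)[of False] by (simp add: bit_vector_def t_def)
  have "subinvariant_at A f \<kappa> t (\<alpha> b)" for b
  proof -
    have "u False * min_cost A f (\<alpha> b) (\<lambda>i. bit_vector t (\<alpha> b i))
        = min_cost A f (\<alpha> b) (\<lambda>i. u (\<alpha> b i))"
      unfolding u_eq[of "\<alpha> b _"] using u(1)[of False] by (simp add: min_cost_mult_left[OF f cube])
    also have "\<dots> \<le> u False * (\<kappa> * bit_vector t b)"
      using u(2)[of b] unfolding u_eq[of b] by (simp add: mult_ac)
    finally show ?thesis
      using u(1)[of False] by (simp add: subinvariant_at_def compatible_selector_eval[OF \<alpha>])
  qed
  with u(1) show thesis
    by (intro that[of t]) (simp_all add: t_def)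
qed

lemma subinvariant_at_decreasing:
  assumes f: "is_bfun f" and x: "x \<in> cube (index f)" "\<not> eval f x"
    and "s \<le> t" and sub: "subinvariant_at A f \<kappa> t x"
  shows "subinvariant_at A f \<kappa> s x"
proof -
  have "min_cost A f x (\<lambda>i. bit_vector s (x i)) \<le> min_cost A f x (\<lambda>i. bit_vector t (x i))"
    using \<open>s \<le> t\<close> by (intro min_cost_mono[OF f x(1)]) (simp add: bit_vector_def)
  with sub x(2) show ?thesis
    by (simp add: subinvariant_at_def bit_vector_def)
qed

lemma subinvariant_at_increasing:
  assumes f: "is_bfun f" and x: "x \<in> cube (index f)" "eval f x"
    and st: "0 < s" "s \<le> t" and sub: "subinvariant_at A f \<kappa> s x"
  shows "subinvariant_at A f \<kappa> t x"
proof -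
  have "min_cost A f x (\<lambda>i. bit_vector t (x i)) \<le> min_cost A f x (\<lambda>i. t / s * bit_vector s (x i))"
    using st by (intro min_cost_mono[OF f x(1)]) (auto simp: bit_vector_def)
  also have "\<dots> = t / s * min_cost A f x (\<lambda>i. bit_vector s (x i))"
    using st by (intro min_cost_mult_left[OF f x(1)]) simp
  also have "\<dots> \<le> t / s * (\<kappa> * s)"
    using sub st x(2) by (intro mult_left_mono) (auto simp: subinvariant_at_def bit_vector_def)
  also have "\<dots> = \<kappa> * t"
    using st(1) by simp
  finally show ?thesis
    using x(2) by (simp add: subinvariant_at_def bit_vector_def)
qed

lemma ex_subinvariant_at:
  assumes f: "is_bfun f" "nonconstant f" and less: "characteristic_value A f < \<kappa>"
  obtains t where "0 < t" "\<And>x. x \<in> cube (index f) \<Longrightarrow> subinvariant_at A f \<kappa> t x"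
proof -
  let ?X = "\<lambda>b. {x \<in> cube (index f). eval f x = b}"
  have "\<exists>t\<in>{0<..}. (\<forall>x\<in>?X False. subinvariant_at A f \<kappa> t x) \<and>
      (\<forall>y\<in>?X True. subinvariant_at A f \<kappa> t y)"
  proof (rule finite_minimax_common_point)
    show "?X False \<noteq> {}" "?X True \<noteq> {}"
      using nonconstant_surj[OF f(2)] by blast+
  next
    fix x y assume "x \<in> ?X False" "y \<in> ?X True"
    then have \<alpha>: "compatible_selector f (\<lambda>b. if b then y else x)"
      by (simp add: compatible_selector_def)
    from le_less_trans[OF selector_value_le_characteristic_value[OF f(1) \<alpha>] less]
    obtain t where "0 < t" "\<And>b. subinvariant_at A f \<kappa> t (if b then y else x)"
      using ex_subinvariant_at_selector[OF f(1) \<alpha>] by blast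
    from this(1) this(2)[of False] this(2)[of True]
    show "\<exists>t\<in>{0<..}. subinvariant_at A f \<kappa> t x \<and> subinvariant_at A f \<kappa> t y"
      by auto
  next
    show "subinvariant_at A f \<kappa> s x"
      if "x \<in> ?X False" "s \<le> t" "subinvariant_at A f \<kappa> t x" for x s t
      using that subinvariant_at_decreasing[OF f(1)] by auto
    show "subinvariant_at A f \<kappa> t y"
      if "y \<in> ?X True" "s \<in> {0<..}" "s \<le> t" "subinvariant_at A f \<kappa> s y" for y s t
      using that subinvariant_at_increasing[OF f(1)] by auto
  qed (use finite_fibre[OF f(1), of False] finite_fibre[OF f(1), of True] in simp_all)
  then obtain t where t: "t \<in> {0<..}" "\<forall>x\<in>?X False. subinvariant_at A f \<kappa> t x"
      "\<forall>y\<in>?X True. subinvariant_at A f \<kappa> t y"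
    by blast
  have "subinvariant_at A f \<kappa> t x" if "x \<in> cube (index f)" for x
    using t(2,3) that by (cases "eval f x") simp_all
  with t(1) show thesis
    by (intro that[of t]) simp_all
qed

lemma ex_subinvariant_growth_map:
  assumes f: "is_bfun f" "nonconstant f" and less: "characteristic_value A f < \<kappa>"
  obtains v where "\<And>b. 0 < v b" "growth_map A f v \<le> (\<lambda>b. \<kappa> * v b)"
proof -
  obtain t where t: "0 < t" "\<And>x. x \<in> cube (index f) \<Longrightarrow> subinvariant_at A f \<kappa> t x"
    using ex_subinvariant_at[OF f less] by blast
  have "0 < bit_vector t b" for b
    using t(1) by (simp add: bit_vector_def)
  moreover have "growth_map A f (bit_vector t) \<le> (\<lambda>b. \<kappa> * bit_vector t b)"
    using t(2) by (auto simp: le_fun_def growth_map_le_iff[OF f] subinvariant_at_def)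
  ultimately show thesis
    by (rule that)
qed

lemma ex_superinvariant_growth_map:
  assumes f: "is_bfun f" "nonconstant f" and less: "\<kappa> < characteristic_value A f"
  obtains v where "\<And>b. 0 \<le> v b" "v False + v True = 1" "(\<lambda>b. \<kappa> * v b) \<le> growth_map A f v"
proof -
  obtain \<alpha> where \<alpha>: "compatible_selector f \<alpha>" "characteristic_value A f = selector_value A f \<alpha>"
    by (rule characteristic_value_attained[OF f])
  note cube = compatible_selector_cube[OF \<alpha>(1)]
  obtain v where v: "\<And>b. 0 \<le> v b" "v False + v True = 1"
    and super: "\<And>b. \<kappa> * v b \<le> min_cost A f (\<alpha> b) (\<lambda>i. v (\<alpha> b i))"
    using ex_superinvariant_vector[OF f(1) cube less[unfolded \<alpha>(2)]] by blast
  have "\<kappa> * v b \<le> growth_map A f v b" for b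
    using order_trans[OF super min_cost_le_growth_map[OF f(1) cube], of b]
    by (simp add: compatible_selector_eval[OF \<alpha>(1)])
  with v show thesis
    by (intro that[of v]) (auto simp: le_fun_def)
qed

end


section \<open>Growth rate of the iterated composition\<close>

lemma mono_iterates_le:
  fixes \<Psi> :: "'b :: order \<Rightarrow> 'b"
  assumes "mono \<Psi>" and "x 0 \<le> y 0"
    and "\<And>n. x (Suc n) \<le> \<Psi> (x n)" and "\<And>n. \<Psi> (y n) \<le> y (Suc n)"
  shows "x n \<le> y n"
proof (induction n)
  case (Suc n)
  have "x (Suc n) \<le> \<Psi> (x n)" by (rule assms)
  also have "\<dots> \<le> \<Psi> (y n)" using \<open>mono \<Psi>\<close> Suc.IH by (rule monoD)
  also have "\<dots> \<le> y (Suc n)" by (rule assms)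
  finally show ?case .
qed (rule assms)

context
  fixes \<Psi> :: "('b \<Rightarrow> real) \<Rightarrow> 'b \<Rightarrow> real" and \<kappa> C :: real
  assumes mono: "mono \<Psi>" and homogeneous: "\<And>k v. 0 \<le> k \<Longrightarrow> \<Psi> (\<lambda>b. k * v b) = (\<lambda>b. k * \<Psi> v b)"
    and nonneg: "0 \<le> \<kappa>" "0 \<le> C"
begin

lemma homogeneous_geometric: "\<Psi> (\<lambda>b. C * \<kappa> ^ n * u b) = (\<lambda>b. C * \<kappa> ^ n * \<Psi> u b)"
  using nonneg by (intro homogeneous) simp

lemma funpow_le_geometric:
  assumes "\<Psi> u \<le> (\<lambda>b. \<kappa> * u b)" and "v \<le> (\<lambda>b. C * u b)"
  shows "(\<Psi> ^^ n) v \<le> (\<lambda>b. C * \<kappa> ^ n * u b)"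
proof (rule mono_iterates_le[OF mono])
  fix n
  have "C * \<kappa> ^ n * \<Psi> u b \<le> C * \<kappa> ^ n * (\<kappa> * u b)" for b
    using assms(1) nonneg by (intro mult_left_mono) (simp_all add: le_fun_def)
  then show "\<Psi> (\<lambda>b. C * \<kappa> ^ n * u b) \<le> (\<lambda>b. C * \<kappa> ^ Suc n * u b)"
    unfolding homogeneous_geometric by (simp add: le_fun_def mult_ac)
qed (use assms(2) in simp_all)

lemma geometric_le_funpow:
  assumes "(\<lambda>b. \<kappa> * u b) \<le> \<Psi> u" and "(\<lambda>b. C * u b) \<le> v"
  shows "(\<lambda>b. C * \<kappa> ^ n * u b) \<le> (\<Psi> ^^ n) v"
proof (rule mono_iterates_le[OF mono])
  fix n
  have "C * \<kappa> ^ n * (\<kappa> * u b) \<le> C * \<kappa> ^ n * \<Psi> u b" for b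
    using assms(1) nonneg by (intro mult_left_mono) (simp_all add: le_fun_def)
  then show "(\<lambda>b. C * \<kappa> ^ Suc n * u b) \<le> \<Psi> (\<lambda>b. C * \<kappa> ^ n * u b)"
    unfolding homogeneous_geometric by (simp add: le_fun_def mult_ac)
qed (use assms(2) in simp_all)

end

lemma root_geometric_tendsto:
  assumes "0 < C" "0 \<le> \<kappa>"
  shows "(\<lambda>k. root k (C * \<kappa> ^ k)) \<longlonglongrightarrow> \<kappa>"
proof -
  have "(\<lambda>k. root k C * \<kappa>) \<longlonglongrightarrow> 1 * \<kappa>"
    by (intro tendsto_mult LIMSEQ_root_const tendsto_const assms)
  moreover have "\<forall>\<^sub>F k in sequentially. root k C * \<kappa> = root k (C * \<kappa> ^ k)"
    using eventually_gt_at_top[of 0]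
    by eventually_elim (simp add: real_root_mult real_root_power_cancel assms)
  ultimately show ?thesis
    by (simp add: tendsto_cong)
qed

lemma root_tendsto_growth_rate:
  fixes a :: "nat \<Rightarrow> real"
  assumes nonneg: "0 \<le> \<rho>" "\<forall>\<^sub>F k in sequentially. 0 \<le> a k"
    and upper: "\<And>\<kappa>. \<rho> < \<kappa> \<Longrightarrow> \<exists>C>0. \<forall>\<^sub>F k in sequentially. a k \<le> C * \<kappa> ^ k"
    and lower: "\<And>\<kappa>. 0 \<le> \<kappa> \<Longrightarrow> \<kappa> < \<rho> \<Longrightarrow> \<exists>C>0. \<forall>\<^sub>F k in sequentially. C * \<kappa> ^ k \<le> a k"
  shows "(\<lambda>k. root k (a k)) \<longlonglongrightarrow> \<rho>"
proof (rule order_tendstoI)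
  fix y assume "\<rho> < y"
  then obtain \<kappa> where \<kappa>: "\<rho> < \<kappa>" "\<kappa> < y"
    using dense by blast
  then obtain C where C: "0 < C" "\<forall>\<^sub>F k in sequentially. a k \<le> C * \<kappa> ^ k"
    using upper by blast
  have "\<forall>\<^sub>F k in sequentially. root k (C * \<kappa> ^ k) < y"
    using root_geometric_tendsto[OF C(1)] nonneg(1) \<kappa> by (intro order_tendstoD(2)) auto
  then show "\<forall>\<^sub>F k in sequentially. root k (a k) < y"
    using C(2) eventually_gt_at_top[of 0]
    by eventually_elim (meson le_less_trans real_root_le_mono)
next
  fix y assume y: "y < \<rho>"
  show "\<forall>\<^sub>F k in sequentially. y < root k (a k)"
  proof (cases "y < 0")
    case True
    then show ?thesis
      using nonneg(2) by (auto elim!: eventually_mono intro: less_le_trans real_root_ge_zero)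
  next
    case False
    obtain \<kappa> where \<kappa>: "y < \<kappa>" "\<kappa> < \<rho>"
      using dense y by blast
    then obtain C where C: "0 < C" "\<forall>\<^sub>F k in sequentially. C * \<kappa> ^ k \<le> a k"
      using lower[of \<kappa>] False by auto
    have "\<forall>\<^sub>F k in sequentially. y < root k (C * \<kappa> ^ k)"
      using root_geometric_tendsto[OF C(1)] \<kappa> False by (intro order_tendstoD(1)) auto
    then show ?thesis
      using C(2) eventually_gt_at_top[of 0]
      by eventually_elim (meson less_le_trans real_root_le_mono)
  qed
qed

context compact_assemblage
begin

lemma measure_nonneg:
  assumes f: "is_bfun f" "nonconstant f"
  shows "0 \<le> measure_of_family A f"
proof -
  obtain x where "x \<in> cube (index f)" "bit_measure A True f = local_measure A f x"
    by (rule bit_measure_attained[OF f])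
  then show ?thesis
    using local_measure_nonneg[OF f(1)] by (simp add: measure_of_family_def le_max_iff_disj)
qed

end

context well_behaved_label_assemblage
begin

lemma measure_pow_le_geometric:
  assumes f: "is_bfun f" "nonconstant f" and less: "characteristic_value A f < \<kappa>"
  shows "\<exists>C>0. \<forall>\<^sub>F k in sequentially. measure_of_family A (bfun_pow f k) \<le> C * \<kappa> ^ k"
proof -
  obtain v where v: "\<And>b. 0 < v b" and sub: "growth_map A f v \<le> (\<lambda>b. \<kappa> * v b)"
    using ex_subinvariant_growth_map[OF f less] by blast
  have \<kappa>: "0 \<le> \<kappa>"
    using characteristic_value_nonneg[OF f] less by simp
  define C where "C = 1 / min (v False) (v True)"
  have C: "0 < C"
    using v by (simp add: C_def)
  have "min (v False) (v True) \<le> v b" for b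
    by (cases b) auto
  then have "(\<lambda>_. 1) \<le> (\<lambda>b. C * v b)"
    using v by (simp add: C_def le_fun_def)
  note geometric = funpow_le_geometric[OF mono_growth_map[OF f] growth_map_mult_left[OF f]
      \<kappa> less_imp_le[OF C] sub this]
  have "measure_of_family A (bfun_pow f (Suc n)) \<le> C * max (v False) (v True) * \<kappa> ^ Suc n" for n
  proof -
    have "bit_measure A b (bfun_pow f (Suc n)) \<le> C * \<kappa> ^ Suc n * v b" for b
      using geometric[of "Suc n"] unfolding bit_measure_pow[OF f] by (simp only: le_fun_def)
    also have "C * \<kappa> ^ Suc n * v b \<le> C * \<kappa> ^ Suc n * max (v False) (v True)" for b
      using C \<kappa> by (intro mult_left_mono) (cases b, auto)
    finally show ?thesis
      by (simp add: measure_of_family_def mult_ac)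
  qed
  moreover have "0 < C * max (v False) (v True)"
    using C v by (simp add: less_max_iff_disj)
  ultimately show ?thesis
    using eventually_sequentially_Suc[of "\<lambda>k. measure_of_family A (bfun_pow f k) \<le> _ * \<kappa> ^ k"]
    by (meson always_eventually)
qed

lemma geometric_le_measure_pow:
  assumes f: "is_bfun f" "nonconstant f" and \<kappa>: "0 \<le> \<kappa>" and less: "\<kappa> < characteristic_value A f"
  shows "\<exists>C>0. \<forall>\<^sub>F k in sequentially. C * \<kappa> ^ k \<le> measure_of_family A (bfun_pow f k)"
proof -
  obtain v where v: "\<And>b. 0 \<le> v b" "v False + v True = 1"
    and super: "(\<lambda>b. \<kappa> * v b) \<le> growth_map A f v"
    using ex_superinvariant_growth_map[OF f less] by blast
  obtain b where b: "0 < v b"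
    using v by (metis add_0 less_le zero_neq_one)
  have "v t \<le> 1" for t
    using v(1)[of False] v(1)[of True] v(2) by (cases t) auto
  then have "(\<lambda>t. 1 * v t) \<le> (\<lambda>_. 1)"
    by (simp add: le_fun_def)
  note geometric = geometric_le_funpow[OF mono_growth_map[OF f] growth_map_mult_left[OF f]
      \<kappa> zero_le_one super this]
  have "v b * \<kappa> ^ Suc n \<le> measure_of_family A (bfun_pow f (Suc n))" for n
  proof -
    have "v b * \<kappa> ^ Suc n \<le> bit_measure A b (bfun_pow f (Suc n))"
      using geometric[of "Suc n"] unfolding bit_measure_pow[OF f]
      by (simp add: le_fun_def mult.commute)
    also have "\<dots> \<le> measure_of_family A (bfun_pow f (Suc n))"
      by (cases b) (simp_all add: measure_of_family_def)
    finally show ?thesis .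
  qed
  with b show ?thesis
    using eventually_sequentially_Suc[of "\<lambda>k. _ * \<kappa> ^ k \<le> measure_of_family A (bfun_pow f k)"]
    by (meson always_eventually)
qed

end

theorem mainTheorem1:
  fixes A :: "'a label family" and f :: "'a label bfun"
  assumes "assemblage A"
    and "well_behaved A"
    and "is_bfun f"
    and "nonconstant f"
  shows "measure_lim A f = ereal (characteristic_value A f)"
proof -
  interpret well_behaved_label_assemblage A
    using assms(1,2) infinite_UNIV_label by unfold_locales
  note f = assms(3,4)
  have "0 \<le> measure_of_family A (bfun_pow f (Suc n))" for n
    by (rule measure_nonneg[OF is_bfun_pow[OF f(1)] nonconstant_pow[OF f(2)]])
  then have "\<forall>\<^sub>F k in sequentially. 0 \<le> measure_of_family A (bfun_pow f k)"
    by (subst eventually_sequentially_Suc[symmetric]) simp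
  then have "(\<lambda>k. root k (measure_of_family A (bfun_pow f k))) \<longlonglongrightarrow> characteristic_value A f"
    using characteristic_value_nonneg[OF f] measure_pow_le_geometric[OF f]
      geometric_le_measure_pow[OF f] by (intro root_tendsto_growth_rate)
  then show ?thesis
    unfolding measure_lim_def by (intro lim_imp_Liminf) simp_all
qed

end
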